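(* For every countable ordinal $\alpha$ with $1<\alpha<\omega_1$, we have $\cong_{\alpha+1}\ \sim_B\ E_{(\cong_\alpha)^{\mathrm{inj}}}$ and $\sqsubseteq_{\alpha+1}\ \sim_B\ (\sqsubseteq_\alpha)^{\mathrm{inj}}$.
   Context: Let $\mathbb U$ be the Urysohn space, $F(\mathbb U)$ the standard Borel space of its nonempty closed subsets. For countable $D\subseteq[0,\infty)$ with $0\in D$, $\mathcal U_D$ is the standard Borel set of $U\in F(\mathbb U)$ which are ultrametric with all realized distances in $D$. For $1\le\alpha<\omega_1$ fix $D_\alpha$ such a set of order type $\alpha$ (in the usual order of reals), write $\mathcal U_\alpha=\mathcal U_{D_\alpha}$, and let $\cong_\alpha$ and $\sqsubseteq_\alpha$ be isometry and isometric embeddability restricted to $\mathcal U_\alpha$ (up to Borel bireducibility these depend only on $\alpha$). For a quasi-order $S$ on $X$, $S^{\mathrm{inj}}$ is the quasi-order on $X^\omega$ given by $(x_n)\mathrel{S^{\mathrm{inj}}}(y_n)$ iff there is an injective $f\colon\omega\to\omega$ with $x_n\mathrel S y_{f(n)}$ for all $n$; $E_S$ denotes the equivalence relation $x\mathrel S y\wedge y\mathrel S x$. $R\sim_B S$ means each Borel reduces to the other. *)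

theory Defs
  imports "HOL-Analysis.Analysis"
begin

unbundle cardinal_syntax

definition isometry_on :: "'a::metric_space set \<Rightarrow> ('a \<Rightarrow> 'b::metric_space) \<Rightarrow> bool" where
  "isometry_on X f \<longleftrightarrow> (\<forall>x\<in>X. \<forall>y\<in>X. dist (f x) (f y) = dist x y)"

definition isometric :: "'a::metric_space set \<Rightarrow> 'a set \<Rightarrow> bool" where
  "isometric X Y \<longleftrightarrow> (\<exists>f. bij_betw f X Y \<and> isometry_on X f)"

definition isometrically_embeds :: "'a::metric_space set \<Rightarrow> 'a set \<Rightarrow> bool" where
  "isometrically_embeds X Y \<longleftrightarrow> (\<exists>f. f ` X \<subseteq> Y \<and> isometry_on X f)"

text \<open>
  The Urysohn space is, up to isometry, the unique Polish metric space that is universal (it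
  contains an isometric copy of every Polish metric space) and ultrahomogeneous. A Polish metric
  space has at most continuum many points, so in the universality clause it is enough
  to let the spaces range over those whose carrier is a set of reals, with an arbitrary metric.
\<close>

definition urysohn_space :: "'u::polish_space itself \<Rightarrow> bool" where
  "urysohn_space _ \<longleftrightarrow>
     (\<forall>m :: real metric. mcomplete_of m \<and> separable_space (mtopology_of m) \<longrightarrow>
        (\<exists>f :: real \<Rightarrow> 'u. \<forall>x\<in>mspace m. \<forall>y\<in>mspace m. dist (f x) (f y) = mdist m x y)) \<and>
     (\<forall>(A :: 'u set) (f :: 'u \<Rightarrow> 'u). finite A \<and> isometry_on A f \<longrightarrow>
        (\<exists>g :: 'u \<Rightarrow> 'u. bij g \<and> isometry_on UNIV g \<and> (\<forall>a\<in>A. g a = f a)))"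

text \<open>Throughout, a measure serves only as a measurable space. The following is the Effros Borel
  structure on the nonempty closed subsets.\<close>

definition effros :: "'u::topological_space set measure" where
  "effros = sigma {X. closed X \<and> X \<noteq> {}}
                  {{X. closed X \<and> X \<noteq> {} \<and> X \<inter> V \<noteq> {}} | V. open V}"

definition ultrametric_on :: "'u::metric_space set \<Rightarrow> bool" where
  "ultrametric_on X \<longleftrightarrow>
     (\<forall>x\<in>X. \<forall>y\<in>X. \<forall>z\<in>X. dist x z \<le> max (dist x y) (dist y z))"

definition ultrametric_subspaces :: "real set \<Rightarrow> 'u::metric_space set measure" where
  "ultrametric_subspaces D =
     restrict_space effros {X. ultrametric_on X \<and> (\<forall>x\<in>X. \<forall>y\<in>X. dist x y \<in> D)}"

text \<open>Ordinals are represented by (reflexive) well-orders, up to order isomorphism \<open>=o\<close>. The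
  successor adds a new greatest element, \<open>None\<close>.\<close>

definition ord_succ :: "'a rel \<Rightarrow> 'a option rel" where
  "ord_succ r = map_prod Some Some ` r \<union> {(Some a, None) | a. a \<in> Field r} \<union> {(None, None)}"

definition distance_set_of_type :: "'a rel \<Rightarrow> real set \<Rightarrow> bool" where
  "distance_set_of_type \<alpha> D \<longleftrightarrow>
     countable D \<and> D \<subseteq> {0..} \<and> 0 \<in> D \<and> {(x, y). x \<in> D \<and> y \<in> D \<and> x \<le> y} =o \<alpha>"

definition inj_power :: "('a \<Rightarrow> 'a \<Rightarrow> bool) \<Rightarrow> (nat \<Rightarrow> 'a) \<Rightarrow> (nat \<Rightarrow> 'a) \<Rightarrow> bool" where
  "inj_power S x y \<longleftrightarrow> (\<exists>f :: nat \<Rightarrow> nat. inj f \<and> (\<forall>n. S (x n) (y (f n))))"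

definition qo_equiv :: "('a \<Rightarrow> 'a \<Rightarrow> bool) \<Rightarrow> 'a \<Rightarrow> 'a \<Rightarrow> bool" where
  "qo_equiv S x y \<longleftrightarrow> S x y \<and> S y x"

abbreviation sequence_space :: "'a measure \<Rightarrow> (nat \<Rightarrow> 'a) measure" where
  "sequence_space M \<equiv> Pi\<^sub>M UNIV (\<lambda>_. M)"

text \<open>A relation on a measurable space \<open>M\<close> is a predicate on the underlying type, of which only the
  restriction to \<open>space M\<close> matters.\<close>

definition borel_reducible ::
    "'a measure \<Rightarrow> ('a \<Rightarrow> 'a \<Rightarrow> bool) \<Rightarrow> 'b measure \<Rightarrow> ('b \<Rightarrow> 'b \<Rightarrow> bool) \<Rightarrow> bool" where
  "borel_reducible M R N S \<longleftrightarrow>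
     (\<exists>f \<in> measurable M N. \<forall>x\<in>space M. \<forall>y\<in>space M. R x y \<longleftrightarrow> S (f x) (f y))"

definition borel_bireducible ::
    "'a measure \<Rightarrow> ('a \<Rightarrow> 'a \<Rightarrow> bool) \<Rightarrow> 'b measure \<Rightarrow> ('b \<Rightarrow> 'b \<Rightarrow> bool) \<Rightarrow> bool" where
  "borel_bireducible M R N S \<longleftrightarrow> borel_reducible M R N S \<and> borel_reducible N S M R"

end

theory Submission
  imports Defs
begin

text \<open>
  Since \<open>D\<close> is well-ordered it has a least positive element \<open>e\<close>, so all spaces involved are uniformly
  discrete and countable. This makes Borel coding elementary: a point of such a space is isolated by
  a basic open set of diameter less than \<open>e\<close>, and conversely a matrix of distances is realized in
  the Urysohn space through a countable universal ultrametric space.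

  Let \<open>r\<close> be the greatest element of \<open>D'\<close>; the remaining distances are those of \<open>D\<close> up to an order
  isomorphism. A sequence of spaces is coded by their disjoint union at mutual distance \<open>r\<close>, whose
  parts are recovered as the open balls of radius \<open>r\<close>. Conversely, a space is sent to the sequence
  of its open balls of radius \<open>r\<close>. There may be finitely many of them, so the sequence is padded with
  singletons; to tell the padding from the balls, each ball is first doubled, that is, every point is
  replaced by two points at distance \<open>e\<close>. Doubling can be cancelled, because it doubles the sizes of
  the closed balls of radius \<open>e\<close> and leaves all larger distances unchanged.
\<close>

section \<open>Distance sets\<close>

text \<open>What remains of \<open>distance_set_of_type\<close> when the order type is forgotten, so
  that D and D' fall under the same lemmas.\<close>

definition wo_distances :: "real set \<Rightarrow> bool" where
  "wo_distances D \<longleftrightarrow> countable D \<and> D \<subseteq> {0..} \<and> 0 \<in> D \<and>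
     (\<forall>S\<subseteq>D. S \<noteq> {} \<longrightarrow> (\<exists>m\<in>S. \<forall>x\<in>S. m \<le> x))"

abbreviation le_rel :: "real set \<Rightarrow> real rel" where
  "le_rel D \<equiv> {(x, y). x \<in> D \<and> y \<in> D \<and> x \<le> y}"

lemma Field_le_rel [simp]: "Field (le_rel D) = D"
  by (auto simp: Field_def)

lemma wo_distances_of_type:
  assumes "distance_set_of_type \<alpha> D"
  shows "wo_distances D"
proof -
  from assms have wo: "Well_order (le_rel D)"
    unfolding distance_set_of_type_def ordIso_def by blast
  then interpret wo_rel "le_rel D" by (simp add: wo_rel_def)
  have "\<exists>m\<in>S. \<forall>x\<in>S. m \<le> x" if "S \<subseteq> D" "S \<noteq> {}" for S
    using minim_in[of S] minim_least[of S] that by auto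
  with assms show ?thesis
    by (auto simp: wo_distances_def distance_set_of_type_def)
qed

text \<open>If 0 were the only distance, the order type would be 1, against 1 < \<alpha>. Doubling
  takes place inside D and uses its least positive element.\<close>

lemma distance_set_nontrivial:
  assumes "distance_set_of_type \<alpha> D" and "natLeq_on 1 <o \<alpha>"
  shows "\<exists>d\<in>D. d > 0"
proof (rule ccontr)
  assume "\<not> ?thesis"
  with assms(1) have "D = {0}"
    by (force simp: distance_set_of_type_def)
  with assms(1) have D0: "le_rel {0} =o \<alpha>"
    unfolding distance_set_of_type_def by blast
  moreover have "iso (le_rel {0}) (natLeq_on 1) (\<lambda>_. 0)"
    unfolding iso_iff2 Field_natLeq_on Field_le_rel by (auto simp: bij_betw_def)
  with D0 have "le_rel {0} =o natLeq_on 1"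
    using natLeq_on_Well_order unfolding ordIso_def by blast
  ultimately have "natLeq_on 1 =o \<alpha>"
    using ordIso_symmetric ordIso_transitive by blast
  with assms(2) show False
    using not_ordLess_ordIso by blast
qed

lemma wo_distances_min_pos:
  assumes "wo_distances D" and "d \<in> D" "d > 0"
  obtains e where "e \<in> D" "e > 0" "\<And>x. x \<in> D \<Longrightarrow> x > 0 \<Longrightarrow> e \<le> x"
proof -
  have "{x\<in>D. x > 0} \<subseteq> D" "{x\<in>D. x > 0} \<noteq> {}" using assms by auto
  then obtain m where "m \<in> {x\<in>D. x > 0}" "\<forall>x\<in>{x\<in>D. x > 0}. m \<le> x"
    using assms(1) unfolding wo_distances_def by meson
  with that show thesis by auto
qed

lemma Field_ord_succ: "Field (ord_succ \<alpha>) = Some ` Field \<alpha> \<union> {None}"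
  by (auto simp: ord_succ_def Field_def Domain_unfold Range_def)

lemma iso_order_iff:
  assumes "iso r s f" "x \<in> Field r" "y \<in> Field r"
  shows "(f x, f y) \<in> s \<longleftrightarrow> (x, y) \<in> r"
  using assms unfolding iso_iff2 by blast

text \<open>\<open>r\<close> is the element of D' that corresponds to the added top
  \<open>None\<close>. The map \<phi> composes the isomorphism from D to \<alpha> with the inverse
  of the one from D' to the successor.\<close>

lemma distance_set_succ:
  assumes D: "distance_set_of_type \<alpha> D" and D': "distance_set_of_type (ord_succ \<alpha>) D'"
  obtains r \<phi> where "r > 0" "r \<in> D'" "\<And>x. x \<in> D' \<Longrightarrow> x \<le> r" "bij_betw \<phi> D (D' - {r})"
    "\<And>x y. x \<in> D \<Longrightarrow> y \<in> D \<Longrightarrow> \<phi> x \<le> \<phi> y \<longleftrightarrow> x \<le> y" "\<phi> 0 = 0"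
proof -
  from D obtain g where g: "iso (le_rel D) \<alpha> g" and wo: "Well_order (le_rel D)" "Well_order \<alpha>"
    by (auto simp: distance_set_of_type_def ordIso_def)
  from D' obtain h where h: "iso (le_rel D') (ord_succ \<alpha>) h"
    and wo': "Well_order (le_rel D')" "Well_order (ord_succ \<alpha>)"
    by (auto simp: distance_set_of_type_def ordIso_def)
  have bg: "bij_betw g D (Field \<alpha>)" using g by (simp add: iso_def)
  have bh: "bij_betw h D' (Some ` Field \<alpha> \<union> {None})"
    using h by (simp add: iso_def Field_ord_succ)
  define k where "k = inv_into D' h"
  have bk: "bij_betw k (Some ` Field \<alpha> \<union> {None}) D'"
    unfolding k_def by (rule bij_betw_inv_into[OF bh])
  have hk: "h (k z) = z" if "z \<in> Some ` Field \<alpha> \<union> {None}" for z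
    unfolding k_def using bij_betw_inv_into_right[OF bh that] .
  define r where "r = k None"
  define \<phi> where "\<phi> = k \<circ> Some \<circ> g"
  have kD: "k z \<in> D'" if "z \<in> Some ` Field \<alpha> \<union> {None}" for z
    using bk that bij_betwE by blast
  have korder: "k z \<le> k w \<longleftrightarrow> (z, w) \<in> ord_succ \<alpha>"
    if "z \<in> Some ` Field \<alpha> \<union> {None}" "w \<in> Some ` Field \<alpha> \<union> {None}" for z w
    using iso_order_iff[OF h, of "k z" "k w"] kD[OF that(1)] kD[OF that(2)]
    by (simp add: hk[OF that(1)] hk[OF that(2)])
  have rD: "r \<in> D'" unfolding r_def by (rule kD) simp
  have rmax: "x \<le> r" if "x \<in> D'" for x
  proof -
    have "(h x, None) \<in> ord_succ \<alpha>"
      using bij_betwE[OF bh] that by (auto simp: ord_succ_def)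
    then show ?thesis
      using iso_order_iff[OF h, of x r] that rD by (simp add: r_def hk)
  qed
  have gF: "g x \<in> Field \<alpha>" if "x \<in> D" for x using bg that bij_betwE by blast
  have bphi: "bij_betw \<phi> D (D' - {r})"
  proof -
    have 1: "bij_betw Some (Field \<alpha>) (Some ` Field \<alpha>)" by (simp add: bij_betw_def)
    have 2: "bij_betw k (Some ` Field \<alpha>) (D' - {r})"
      using bk unfolding bij_betw_def inj_on_def r_def by (auto 0 3)
    show ?thesis unfolding \<phi>_def comp_assoc
      using bij_betw_trans[OF bij_betw_trans[OF bg 1] 2] by (simp add: comp_assoc)
  qed
  have mono: "\<phi> x \<le> \<phi> y \<longleftrightarrow> x \<le> y" if "x \<in> D" "y \<in> D" for x y
    using korder[of "Some (g x)" "Some (g y)"] gF that iso_order_iff[OF g, of x y]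
    by (auto simp: \<phi>_def ord_succ_def)
  have zero: "0 \<in> D" "0 \<in> D'" and nonneg: "\<And>x. x \<in> D' \<Longrightarrow> x \<ge> 0" "\<And>x. x \<in> D \<Longrightarrow> x \<ge> 0"
    using D D' by (auto simp: distance_set_of_type_def)
  have "\<phi> 0 \<in> D'" "\<phi> 0 \<noteq> r" using bphi zero bij_betwE by blast+
  then have rpos: "r > 0" using rmax[of "\<phi> 0"] nonneg(1)[of "\<phi> 0"] by linarith
  \<comment> \<open>As r is positive, 0 is a value \<phi> x; monotonicity and 0 \<le> x then force
    \<phi> 0 down to 0.\<close>
  then have "0 \<in> \<phi> ` D" using zero bphi by (auto simp: bij_betw_def)
  then obtain x where x: "x \<in> D" "\<phi> x = 0" by auto
  then have "\<phi> 0 \<le> 0" using mono[of 0 x] nonneg zero by simp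
  then have "\<phi> 0 = 0" using nonneg(1)[OF \<open>\<phi> 0 \<in> D'\<close>] by simp
  with rpos rD rmax bphi mono show thesis by (rule that)
qed

section \<open>A countable universal ultrametric space\<close>

text \<open>Distinct indices may be at distance 0. Enumerations with repetitions are thus allowed,
  and finite spaces are given by matrices over an infinite index type.\<close>

definition pseudo_ultrametric :: "real set \<Rightarrow> ('i \<Rightarrow> 'i \<Rightarrow> real) \<Rightarrow> bool" where
  "pseudo_ultrametric D \<delta> \<longleftrightarrow> (\<forall>i. \<delta> i i = 0) \<and> (\<forall>i j. \<delta> i j = \<delta> j i) \<and>
     (\<forall>i j k. \<delta> i k \<le> max (\<delta> i j) (\<delta> j k)) \<and> (\<forall>i j. \<delta> i j \<in> D)"

text \<open>The classical model of a universal ultrametric space: a point is a function on D whose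
  values from t on name its closed ball of radius t, and the distance of two points is the least
  radius from which on all their balls coincide.\<close>

definition tail_agreement :: "real set \<Rightarrow> (real \<Rightarrow> nat) \<Rightarrow> (real \<Rightarrow> nat) \<Rightarrow> real set" where
  "tail_agreement D f g = {t\<in>D. \<forall>u\<in>D. t \<le> u \<longrightarrow> f u = g u}"

definition gap :: "real set \<Rightarrow> (real \<Rightarrow> nat) \<Rightarrow> (real \<Rightarrow> nat) \<Rightarrow> real" where
  "gap D f g = (LEAST t. t \<in> tail_agreement D f g)"

text \<open>Two functions that vanish eventually agree from the larger of their thresholds on, so
  the minimum that defines \<open>gap\<close> exists.\<close>

definition profiles :: "real set \<Rightarrow> (real \<Rightarrow> nat) set" where
  "profiles D = {f. (\<forall>t. t \<notin> D \<longrightarrow> f t = 0) \<and> (\<exists>t\<in>D. \<forall>u\<in>D. t \<le> u \<longrightarrow> f u = 0)}"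

lemma gap_eqI:
  assumes "t \<in> tail_agreement D f g" "\<And>u. u \<in> tail_agreement D f g \<Longrightarrow> t \<le> u"
  shows "gap D f g = t"
  unfolding gap_def by (rule Least_equality) (use assms in auto)

lemma gap_least:
  assumes D: "wo_distances D" and "f \<in> profiles D" "g \<in> profiles D"
  shows "gap D f g \<in> tail_agreement D f g \<and> (\<forall>t\<in>tail_agreement D f g. gap D f g \<le> t)"
proof -
  obtain s t where "s \<in> D" "\<forall>u\<in>D. s \<le> u \<longrightarrow> f u = 0" "t \<in> D" "\<forall>u\<in>D. t \<le> u \<longrightarrow> g u = 0"
    using assms(2,3) by (auto simp: profiles_def)
  then have "max s t \<in> tail_agreement D f g"
    by (auto simp: tail_agreement_def max_def)
  moreover have "tail_agreement D f g \<subseteq> D" by (auto simp: tail_agreement_def)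
  ultimately obtain m where "m \<in> tail_agreement D f g" "\<forall>x\<in>tail_agreement D f g. m \<le> x"
    using D unfolding wo_distances_def by (metis empty_iff)
  then show ?thesis using gap_eqI[of m D f g] by auto
qed

lemma gap_ultrametric:
  assumes D: "wo_distances D" and fgh: "f \<in> profiles D" "g \<in> profiles D" "h \<in> profiles D"
  shows "gap D f g \<in> D" "gap D f g = gap D g f" "gap D f g = 0 \<longleftrightarrow> f = g"
    "gap D f h \<le> max (gap D f g) (gap D g h)"
proof -
  note fg = gap_least[OF D fgh(1,2)] and gh = gap_least[OF D fgh(2,3)]
    and fh = gap_least[OF D fgh(1,3)]
  show gD: "gap D f g \<in> D" using fg by (auto simp: tail_agreement_def)
  have "tail_agreement D f g = tail_agreement D g f" by (auto simp: tail_agreement_def)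
  then show "gap D f g = gap D g f" by (simp add: gap_def)
  show "gap D f g = 0 \<longleftrightarrow> f = g"
  proof
    assume "gap D f g = 0"
    then have "f u = g u" if "u \<in> D" for u
      using fg D that by (auto simp: tail_agreement_def wo_distances_def)
    moreover have "f u = g u" if "u \<notin> D" for u
      using that fgh by (auto simp: profiles_def)
    ultimately show "f = g" by blast
  next
    assume "f = g"
    then show "gap D f g = 0"
      using D by (intro gap_eqI) (auto simp: tail_agreement_def wo_distances_def)
  qed
  have "max (gap D f g) (gap D g h) \<in> tail_agreement D f h"
    using fg gh by (auto simp: tail_agreement_def max_def)
  with fh show "gap D f h \<le> max (gap D f g) (gap D g h)" by blast
qed

text \<open>The list is meant to hold the distances to a point from its predecessors and from
  itself. Finite lists are used because there are only countably many over D. Below all entries of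
  the list the value is unspecified; membership in \<open>profiles\<close> only concerns the values
  from \<open>hd l\<close> on and those outside D.\<close>

definition list_profile :: "real set \<Rightarrow> real list \<Rightarrow> real \<Rightarrow> nat" where
  "list_profile D l t = (if t \<in> D then LEAST k. k < length l \<and> l ! k \<le> t else 0)"

lemma list_profile_in_profiles:
  assumes "l \<noteq> []" "set l \<subseteq> D"
  shows "list_profile D l \<in> profiles D"
proof -
  have "list_profile D l u = 0" if "hd l \<le> u" for u
    unfolding list_profile_def using assms that by (auto intro!: Least_equality simp: hd_conv_nth)
  moreover have "hd l \<in> D" using assms by auto
  moreover have "list_profile D l u = 0" if "u \<notin> D" for u
    using that by (simp add: list_profile_def)
  ultimately show ?thesis unfolding profiles_def by blast
qed

definition dist_row :: "(nat \<Rightarrow> nat \<Rightarrow> real) \<Rightarrow> nat \<Rightarrow> real list" where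
  "dist_row \<delta> n = map (\<lambda>i. \<delta> i n) [0..<Suc n]"

lemma length_dist_row [simp]: "length (dist_row \<delta> n) = Suc n"
  by (simp add: dist_row_def)

lemma dist_row_nth [simp]: "i < Suc n \<Longrightarrow> dist_row \<delta> n ! i = \<delta> i n"
  by (simp add: dist_row_def del: upt_Suc)

text \<open>The profile of the \<open>n\<close>-th row maps \<open>t\<close> to the least index in the closed ball of radius \<open>t\<close> around \<open>n\<close>.
  As balls of the same radius are equal or disjoint, two profiles agree at \<open>t\<close> iff the distance of
  the points is at most \<open>t\<close>.\<close>

lemma gap_rows:
  assumes D: "wo_distances D" and \<delta>: "pseudo_ultrametric D \<delta>"
  shows "gap D (list_profile D (dist_row \<delta> n)) (list_profile D (dist_row \<delta> m)) = \<delta> n m"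
proof -
  have refl: "\<delta> i i = 0" and sym: "\<delta> i j = \<delta> j i" and ult: "\<delta> i k \<le> max (\<delta> i j) (\<delta> j k)"
    and inD: "\<delta> i j \<in> D" for i j k
    using \<delta> by (auto simp: pseudo_ultrametric_def)
  have nonneg: "t \<ge> 0" if "t \<in> D" for t using D that by (auto simp: wo_distances_def)
  \<comment> \<open>Cutting the row off after n loses nothing: \<delta> n n = 0 \<le> t, so the
    least index in the ball is at most n.\<close>
  have code: "list_profile D (dist_row \<delta> n) t = (LEAST k. \<delta> k n \<le> t)" if "t \<in> D" for n t
  proof -
    define k where "k = (LEAST k. \<delta> k n \<le> t)"
    have n: "\<delta> n n \<le> t" using refl nonneg that by simp
    have "\<delta> k n \<le> t" unfolding k_def by (rule LeastI) (rule n)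
    moreover have "k \<le> n" unfolding k_def by (rule Least_le) (rule n)
    moreover have "k \<le> j" if "\<delta> j n \<le> t" for j unfolding k_def by (rule Least_le) (rule that)
    ultimately have "(LEAST k. k < length (dist_row \<delta> n) \<and> dist_row \<delta> n ! k \<le> t) = k"
      by (intro Least_equality) auto
    then show ?thesis using that by (simp add: list_profile_def k_def)
  qed
  have agree: "list_profile D (dist_row \<delta> n) t = list_profile D (dist_row \<delta> m) t \<longleftrightarrow> \<delta> n m \<le> t"
    if "t \<in> D" for t
  proof
    assume "\<delta> n m \<le> t"
    then have "\<delta> k n \<le> t \<longleftrightarrow> \<delta> k m \<le> t" for k
      using ult[of k m n] ult[of k n m] sym[of n m] by linarith
    then show "list_profile D (dist_row \<delta> n) t = list_profile D (dist_row \<delta> m) t"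
      using that by (simp add: code)
  next
    assume eq: "list_profile D (dist_row \<delta> n) t = list_profile D (dist_row \<delta> m) t"
    define k where "k = (LEAST k. \<delta> k n \<le> t)"
    have "\<delta> k n \<le> t" unfolding k_def by (rule LeastI[of _ n]) (simp add: refl nonneg that)
    moreover have "k = (LEAST k. \<delta> k m \<le> t)" using eq that by (simp add: code k_def)
    moreover have "\<delta> (LEAST k. \<delta> k m \<le> t) m \<le> t"
      by (rule LeastI[of _ m]) (simp add: refl nonneg that)
    ultimately show "\<delta> n m \<le> t" using ult[of n m k] sym[of n k] by auto
  qed
  have "tail_agreement D (list_profile D (dist_row \<delta> n)) (list_profile D (dist_row \<delta> m)) = {t\<in>D. \<delta> n m \<le> t}"
    unfolding tail_agreement_def using agree inD by (auto intro: order_trans)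
  then show ?thesis by (intro gap_eqI) (auto simp: inD)
qed

section \<open>Realizing matrices of distances in the Urysohn space\<close>

text \<open>Universality speaks of carriers that are sets of reals, so P is transported along an
  injection into the natural numbers. Uniform discreteness makes Cauchy sequences eventually
  constant, which gives completeness; the countable carrier is its own dense subset.\<close>

lemma urysohn_countable_uniformly_discrete:
  fixes \<rho> :: "'p \<Rightarrow> 'p \<Rightarrow> real"
  assumes U: "urysohn_space TYPE('u::polish_space)" and P: "countable P" and \<rho>: "Metric_space P \<rho>"
    and e: "e > 0" "\<And>x y. x \<in> P \<Longrightarrow> y \<in> P \<Longrightarrow> x \<noteq> y \<Longrightarrow> \<rho> x y \<ge> e"
  shows "\<exists>E :: 'p \<Rightarrow> 'u. \<forall>x\<in>P. \<forall>y\<in>P. dist (E x) (E y) = \<rho> x y"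
proof -
  interpret P: Metric_space P \<rho> by fact
  define c where "c = real \<circ> to_nat_on P"
  define c' where "c' = inv_into P c"
  have inj: "inj_on c P" unfolding c_def
    using P by (intro comp_inj_on inj_on_to_nat_on) (auto intro: inj_onI)
  have [simp]: "c' (c x) = x" if "x \<in> P" for x unfolding c'_def using inj that by simp
  interpret M: Metric_space "c ` P" "\<lambda>x y. \<rho> (c' x) (c' y)"
  proof
    show "0 \<le> \<rho> (c' x) (c' y)" for x y by simp
    show "\<rho> (c' x) (c' y) = \<rho> (c' y) (c' x)" for x y by (rule P.commute)
    show "\<rho> (c' x) (c' y) = 0 \<longleftrightarrow> x = y" if "x \<in> c ` P" "y \<in> c ` P" for x y
      using that by (elim imageE) (simp add: P.zero inj_on_eq_iff[OF inj])
    show "\<rho> (c' x) (c' z) \<le> \<rho> (c' x) (c' y) + \<rho> (c' y) (c' z)"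
      if "x \<in> c ` P" "y \<in> c ` P" "z \<in> c ` P" for x y z
      using that by (elim imageE) (simp add: P.triangle)
  qed
  have "M.mcomplete"
    unfolding M.mcomplete_def
  proof (intro allI impI)
    fix s assume s: "M.MCauchy s"
    then obtain N where N: "\<And>n. n \<ge> N \<Longrightarrow> \<rho> (c' (s N)) (c' (s n)) < e"
      using e(1) unfolding M.MCauchy_def by (meson order_refl)
    have sP: "s n \<in> c ` P" for n using s unfolding M.MCauchy_def by (meson rangeI subsetD)
    have "s n = s N" if "n \<ge> N" for n
    proof (rule ccontr)
      assume "s n \<noteq> s N"
      moreover obtain x y where "x \<in> P" "y \<in> P" "s N = c x" "s n = c y"
        using sP[of n] sP[of N] by (elim imageE)
      ultimately show False
        using N[OF that] e(2)[of x y] by auto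
    qed
    then have "eventually (\<lambda>n. s n = s N) sequentially"
      by (rule eventually_sequentiallyI)
    then have "limitin M.mtopology s (s N) sequentially"
      using sP by (intro limitin_eventually) auto
    then show "\<exists>x. limitin M.mtopology s x sequentially" by blast
  qed
  moreover have "separable_space M.mtopology"
    unfolding separable_space_def using P
    by (intro exI[of _ "c ` P"]) (metis M.topspace_mtopology closure_of_topspace countable_image order_refl)
  ultimately obtain f :: "real \<Rightarrow> 'u" where
    "\<forall>x\<in>c ` P. \<forall>y\<in>c ` P. dist (f x) (f y) = \<rho> (c' x) (c' y)"
    using U unfolding urysohn_space_def
    by (elim conjE allE[of _ "metric (c ` P, \<lambda>x y. \<rho> (c' x) (c' y))"]) auto
  then have "\<forall>x\<in>P. \<forall>y\<in>P. dist ((f \<circ> c) x) ((f \<circ> c) y) = \<rho> x y" by simp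
  then show ?thesis by blast
qed

lemma countable_lists_of: "countable D \<Longrightarrow> countable {l. set l \<subseteq> D}"
  using countable_lists[of D] by (simp add: lists_eq_set)

text \<open>The order of the quantifiers matters: one \<open>p\<close> serves all matrices, and the
  n-th point depends on the n-th row alone. This is what later turns Borel families of matrices into
  Borel families of subspaces.\<close>

lemma urysohn_row_points:
  assumes U: "urysohn_space TYPE('u::polish_space)" and D: "wo_distances D" "d \<in> D" "d > 0"
  shows "\<exists>p :: real list \<Rightarrow> 'u. \<forall>\<delta>. pseudo_ultrametric D \<delta> \<longrightarrow>
           (\<forall>n m. dist (p (dist_row \<delta> n)) (p (dist_row \<delta> m)) = \<delta> n m)"
proof -
  obtain e where e: "e \<in> D" "e > 0" "\<And>x. x \<in> D \<Longrightarrow> x > 0 \<Longrightarrow> e \<le> x"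
    using wo_distances_min_pos[OF D] by blast
  define P where "P = list_profile D ` {l. l \<noteq> [] \<and> set l \<subseteq> D}"
  have sub: "P \<subseteq> profiles D" by (auto simp: P_def intro: list_profile_in_profiles)
  have "countable {l. l \<noteq> [] \<and> set l \<subseteq> D}"
    using D(1) by (rule_tac countable_subset[OF _ countable_lists_of[of D]]) (auto simp: wo_distances_def)
  then have cP: "countable P" unfolding P_def by (rule countable_image)
  note gu = gap_ultrametric[OF D(1)]
  have nonneg: "gap D f g \<ge> 0" if "f \<in> P" "g \<in> P" for f g
    using gu(1)[of f g f] that sub D(1) by (auto simp: wo_distances_def)
  \<comment> \<open>The value 0 off P is chosen because \<open>Metric_space\<close> asks for
    nonnegativity and symmetry on the whole type.\<close>
  define \<rho> where "\<rho> f g = (if f \<in> P \<and> g \<in> P then gap D f g else 0)" for f g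
  have "Metric_space P \<rho>"
  proof
    show "0 \<le> \<rho> f g" for f g unfolding \<rho>_def using nonneg by auto
    show "\<rho> f g = \<rho> g f" for f g unfolding \<rho>_def using gu(2) sub by auto
    show "\<rho> f g = 0 \<longleftrightarrow> f = g" if "f \<in> P" "g \<in> P" for f g
      unfolding \<rho>_def using that gu(3) sub by auto
    show "\<rho> f h \<le> \<rho> f g + \<rho> g h" if "f \<in> P" "g \<in> P" "h \<in> P" for f g h
    proof -
      have "gap D f h \<le> max (gap D f g) (gap D g h)" using that sub by (intro gu(4)) auto
      then show ?thesis
        using nonneg[OF that(1,2)] nonneg[OF that(2,3)] that by (simp add: \<rho>_def)
    qed
  qed
  moreover have "\<rho> f g \<ge> e" if "f \<in> P" "g \<in> P" "f \<noteq> g" for f g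
  proof -
    have "\<rho> f g \<in> D" "\<rho> f g \<noteq> 0" using that gu(1,3)[of f g g] sub by (auto simp: \<rho>_def)
    moreover have "\<rho> f g \<ge> 0" using nonneg that by (simp add: \<rho>_def)
    ultimately show ?thesis using e by simp
  qed
  ultimately obtain E :: "(real \<Rightarrow> nat) \<Rightarrow> 'u" where
    E: "\<forall>f\<in>P. \<forall>g\<in>P. dist (E f) (E g) = \<rho> f g"
    using urysohn_countable_uniformly_discrete[OF U cP _ e(2), of \<rho>] by blast
  have "dist (E (list_profile D (dist_row \<delta> n))) (E (list_profile D (dist_row \<delta> m))) = \<delta> n m"
    if \<delta>: "pseudo_ultrametric D \<delta>" for \<delta> n m
  proof -
    have "dist_row \<delta> n \<noteq> []" "set (dist_row \<delta> n) \<subseteq> D" for n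
    proof -
      show "dist_row \<delta> n \<noteq> []" by (simp add: dist_row_def)
      show "set (dist_row \<delta> n) \<subseteq> D"
        using \<delta> unfolding dist_row_def pseudo_ultrametric_def set_map by blast
    qed
    then have "list_profile D (dist_row \<delta> n) \<in> P" for n by (auto simp: P_def)
    then show ?thesis using E gap_rows[OF D(1) \<delta>, of n m] by (simp add: \<rho>_def)
  qed
  then show ?thesis by (intro exI[of _ "\<lambda>l. E (list_profile D l)"]) simp
qed

section \<open>Borel maps into the space of ultrametric subspaces\<close>

lemma space_effros: "space effros = {X. closed X \<and> X \<noteq> {}}"
  unfolding effros_def by (rule space_measure_of) blast

lemma space_ultrametric_subspaces:
  "X \<in> space (ultrametric_subspaces D) \<longleftrightarrow>
     closed X \<and> X \<noteq> {} \<and> ultrametric_on X \<and> (\<forall>x\<in>X. \<forall>y\<in>X. dist x y \<in> D)"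
  by (auto simp: ultrametric_subspaces_def space_restrict_space space_effros)

lemma hits_measurable [measurable]:
  assumes "open V"
  shows "Measurable.pred (ultrametric_subspaces D) (\<lambda>X. X \<inter> V \<noteq> {})"
proof -
  have "{X. closed X \<and> X \<noteq> {} \<and> X \<inter> V \<noteq> {}} \<in> sets effros"
    unfolding effros_def using assms by (intro in_measure_of) auto
  then have "{X\<in>space effros. X \<inter> V \<noteq> {}} \<in> sets effros"
    by (rule back_subst[of "\<lambda>S. S \<in> sets effros"]) (auto simp: space_effros)
  then show ?thesis unfolding ultrametric_subspaces_def
    by (intro measurable_restrict_space1) (simp add: pred_def)
qed

lemma measurable_into_ultrametric_subspaces:
  assumes "\<And>x. x \<in> space M \<Longrightarrow> F x \<in> space (ultrametric_subspaces D)"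
    and "\<And>V. open V \<Longrightarrow> {x\<in>space M. F x \<inter> V \<noteq> {}} \<in> sets M"
  shows "F \<in> M \<rightarrow>\<^sub>M ultrametric_subspaces D"
proof -
  have "F \<in> M \<rightarrow>\<^sub>M effros"
    unfolding effros_def
  proof (rule measurable_measure_of)
    show "F \<in> space M \<rightarrow> {X. closed X \<and> X \<noteq> {}}"
      using assms(1) by (auto simp: space_ultrametric_subspaces)
    fix S :: "'b set set" assume "S \<in> {{X. closed X \<and> X \<noteq> {} \<and> X \<inter> V \<noteq> {}} |V. open V}"
    then obtain V where V: "open V" "S = {X. closed X \<and> X \<noteq> {} \<and> X \<inter> V \<noteq> {}}" by auto
    then have "F -` S \<inter> space M = {x\<in>space M. F x \<inter> V \<noteq> {}}"
      using assms(1) by (auto simp: space_ultrametric_subspaces)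
    then show "F -` S \<inter> space M \<in> sets M" using assms(2)[OF V(1)] by simp
  qed blast
  then show ?thesis unfolding ultrametric_subspaces_def
    using assms(1) by (intro measurable_restrict_space2)
      (auto simp: ultrametric_subspaces_def space_restrict_space)
qed

text \<open>The points are supplied by \<open>urysohn_row_points\<close> after numbering the
  indices. Their range is closed because distances below the least positive element of D
  vanish.\<close>

lemma measurable_realization:
  fixes \<delta> :: "'m \<Rightarrow> 'i::countable \<Rightarrow> 'i \<Rightarrow> real"
  assumes U: "urysohn_space TYPE('u::polish_space)" and D: "wo_distances D" "d \<in> D" "d > 0"
    and \<delta>: "\<And>x. x \<in> space M \<Longrightarrow> pseudo_ultrametric D (\<delta> x)"
    and meas: "\<And>i j. (\<lambda>x. \<delta> x i j) \<in> borel_measurable M"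
  obtains h :: "'m \<Rightarrow> 'i \<Rightarrow> 'u::polish_space"
    where "\<And>x i j. x \<in> space M \<Longrightarrow> dist (h x i) (h x j) = \<delta> x i j"
      and "(\<lambda>x. range (h x)) \<in> M \<rightarrow>\<^sub>M ultrametric_subspaces D"
proof -
  obtain p :: "real list \<Rightarrow> 'u" where p: "\<And>\<delta> n m. pseudo_ultrametric D \<delta> \<Longrightarrow>
      dist (p (dist_row \<delta> n)) (p (dist_row \<delta> m)) = \<delta> n m"
    using urysohn_row_points[OF U D] by blast
  \<comment> \<open>On a finite index type \<open>from_nat\<close> repeats indices; the new matrix
    is still a pseudo-ultrametric.\<close>
  define \<delta>' where "\<delta>' x n m = \<delta> x (from_nat n) (from_nat m)" for x n m
  define h where "h x i = p (dist_row (\<delta>' x) (to_nat i))" for x and i :: 'i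
  have \<delta>': "pseudo_ultrametric D (\<delta>' x)" if "x \<in> space M" for x
    using \<delta>[OF that] unfolding pseudo_ultrametric_def \<delta>'_def by blast
  have dist_h: "dist (h x i) (h x j) = \<delta> x i j" if "x \<in> space M" for x i j
    using p[OF \<delta>'[OF that], of "to_nat i" "to_nat j"] by (simp add: h_def \<delta>'_def)
  obtain e where e: "e \<in> D" "e > 0" "\<And>x. x \<in> D \<Longrightarrow> x > 0 \<Longrightarrow> e \<le> x"
    using wo_distances_min_pos[OF D] by blast
  have "(\<lambda>x. range (h x)) \<in> M \<rightarrow>\<^sub>M ultrametric_subspaces D"
  proof (rule measurable_into_ultrametric_subspaces)
    fix x assume x: "x \<in> space M"
    have inD: "\<delta> x i j \<in> D" for i j using \<delta>[OF x] by (auto simp: pseudo_ultrametric_def)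
    have "closed (range (h x))"
    proof (rule discrete_imp_closed[OF e(2)], intro ballI impI)
      fix y z assume "y \<in> range (h x)" "z \<in> range (h x)" and lt: "dist z y < e"
      then have "dist z y \<in> D" using inD by (auto simp: dist_h[OF x])
      with lt e(3)[of "dist z y"] show "z = y" by (cases "z = y") auto
    qed
    moreover have "ultrametric_on (range (h x))"
      using \<delta>[OF x] by (auto simp: ultrametric_on_def dist_h[OF x] pseudo_ultrametric_def)
    ultimately show "range (h x) \<in> space (ultrametric_subspaces D)"
      using inD by (auto simp: space_ultrametric_subspaces dist_h[OF x])
  next
    fix V :: "'u set"
    have row: "{x\<in>space M. dist_row (\<delta>' x) n = l} \<in> sets M" for n l
    proof -
      have "{x\<in>space M. dist_row (\<delta>' x) n = l} =
          {x\<in>space M. length l = Suc n \<and> (\<forall>k\<in>{..n}. \<delta> x (from_nat k) (from_nat n) = l ! k)}"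
        by (auto simp: list_eq_iff_nth_eq \<delta>'_def less_Suc_eq_le)
      also have "\<dots> \<in> sets M" using meas by measurable
      finally show ?thesis .
    qed
    have rowD: "set (dist_row (\<delta>' x) n) \<subseteq> D" if "x \<in> space M" for x n
      using \<delta>'[OF that] unfolding dist_row_def pseudo_ultrametric_def set_map by blast
    \<comment> \<open>Only countably many rows have their entries in D, so the set is a countable
      union whatever the preimage of V under \<open>p\<close> looks like.\<close>
    have "{x\<in>space M. range (h x) \<inter> V \<noteq> {}} =
        (\<Union>i::'i. \<Union>l\<in>{l. set l \<subseteq> D} \<inter> p -` V. {x\<in>space M. dist_row (\<delta>' x) (to_nat i) = l})"
      using rowD by (auto simp: h_def)
    also have "\<dots> \<in> sets M"
      using row D countable_lists_of[of D]
      by (intro sets.countable_UN' countable_Int1) (auto simp: wo_distances_def)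
    finally show "{x\<in>space M. range (h x) \<inter> V \<noteq> {}} \<in> sets M" .
  qed
  with dist_h show thesis by (rule that)
qed

section \<open>Enumerating a uniformly discrete space measurably\<close>

text \<open>Balls of radius e/2 around a countable dense set cover the whole space, and each meets X
  in at most one point, since distinct points of X are at least e apart. Listing these points
  enumerates X with repetitions.\<close>

lemma measurable_enumeration:
  assumes D: "wo_distances D" "d \<in> D" "d > 0"
  obtains s :: "'u::polish_space set \<Rightarrow> nat \<Rightarrow> 'u"
    where "\<And>n. (\<lambda>X. s X n) \<in> borel_measurable (ultrametric_subspaces D)"
      and "\<And>X. X \<in> space (ultrametric_subspaces D) \<Longrightarrow> range (s X) = X"
proof -
  let ?M = "ultrametric_subspaces D :: 'u set measure"
  obtain e where e: "e \<in> D" "e > 0" "\<And>x. x \<in> D \<Longrightarrow> x > 0 \<Longrightarrow> e \<le> x"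
    using wo_distances_min_pos[OF D] by blast
  obtain Q :: "'u set" where Q: "countable Q" "\<And>V. open V \<Longrightarrow> V \<noteq> {} \<Longrightarrow> \<exists>q\<in>Q. q \<in> V"
    using countable_dense_setE by blast
  have "Q \<noteq> {}" using Q(2)[of UNIV] by auto
  define B where "B n = ball (from_nat_into Q n) (e / 2)" for n
  have oB: "open (B n)" for n by (simp add: B_def)
  have cover: "\<exists>n. x \<in> B n" for x
  proof -
    obtain q where "q \<in> Q" "q \<in> ball x (e / 2)" using Q(2)[of "ball x (e / 2)"] e(2) by auto
    moreover from this obtain n where "q = from_nat_into Q n"
      using from_nat_into_surj[OF Q(1)] by metis
    ultimately show ?thesis by (auto simp: B_def dist_commute)
  qed
  define t where "t m X = (THE x. x \<in> X \<inter> B m)" for m X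
  \<comment> \<open>A ball that misses X is replaced by the first one that meets it, so that every
    term of the enumeration is a point of X.\<close>
  define k where "k n X = (if X \<inter> B n \<noteq> {} then n else LEAST m. X \<inter> B m \<noteq> {})" for n X
  have uniq: "x = y" if X: "X \<in> space ?M" and xy: "x \<in> X \<inter> B m" "y \<in> X \<inter> B m" for X x y m
  proof (rule ccontr)
    assume "x \<noteq> y"
    with X xy have "e \<le> dist x y" by (intro e(3)) (auto simp: space_ultrametric_subspaces)
    moreover have "dist x y \<le> dist (from_nat_into Q m) x + dist (from_nat_into Q m) y"
      by (metis dist_commute dist_triangle)
    ultimately show False using xy by (auto simp: B_def)
  qed
  have t_eq: "t m X = x" if "X \<in> space ?M" "x \<in> X \<inter> B m" for X x m
    unfolding t_def using that uniq by (intro the_equality) auto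
  have t_meas: "t m \<in> borel_measurable ?M" for m
  proof (rule borel_measurableI)
    fix V :: "'u set" assume V: "open V"
    \<comment> \<open>The default that \<open>THE\<close> returns when nothing satisfies the
      description: \<open>t m\<close> is constant on the spaces that miss
      \<open>B m\<close>.\<close>
    define c :: 'u where "c = (THE x. False)"
    \<comment> \<open>The next identity splits the preimage: a space meeting \<open>B m\<close> does
      so in one point, which lies in V iff the space meets \<open>B m\<close> inside V.\<close>
    have emp: "t m X = c" if "X \<inter> B m = {}" for X using that by (simp add: t_def c_def)
    have "t m -` V \<inter> space ?M =
        {X\<in>space ?M. X \<inter> (B m \<inter> V) \<noteq> {} \<or> \<not> X \<inter> B m \<noteq> {} \<and> c \<in> V}" (is "?L = ?R")
    proof (intro set_eqI)
      fix X
      show "X \<in> ?L \<longleftrightarrow> X \<in> ?R"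
      proof (cases "X \<in> space ?M \<and> X \<inter> B m \<noteq> {}")
        case True
        then obtain x where "x \<in> X \<inter> B m" by auto
        then show ?thesis using True uniq[of X] t_eq[of X] by auto
      next
        case False
        then show ?thesis using emp[of X] by auto
      qed
    qed
    also have "\<dots> \<in> sets ?M"
    proof -
      have [measurable]: "open (B m \<inter> V)" "open (B m)" using V oB by auto
      show ?thesis by measurable
    qed
    finally show "t m -` V \<inter> space ?M \<in> sets ?M" .
  qed
  have hit: "Measurable.pred ?M (\<lambda>X. X \<inter> B m \<noteq> {})" for m
    by (rule hits_measurable) (rule oB)
  have k_meas: "k n \<in> ?M \<rightarrow>\<^sub>M count_space UNIV" for n
    unfolding k_def using hit[measurable] by measurable
  define s where "s X n = t (k n X) X" for X n
  show thesis
  proof (rule that)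
    show "(\<lambda>X. s X n) \<in> borel_measurable ?M" for n
      unfolding s_def by (rule measurable_compose_countable[OF t_meas k_meas])
  next
    fix X assume X: "X \<in> space ?M"
    then have "X \<noteq> {}" by (simp add: space_ultrametric_subspaces)
    then have "\<exists>m. X \<inter> B m \<noteq> {}" using cover by blast
    then have "X \<inter> B (LEAST m. X \<inter> B m \<noteq> {}) \<noteq> {}" by (rule LeastI_ex)
    then have "X \<inter> B (k n X) \<noteq> {}" for n by (simp add: k_def)
    then have "s X n \<in> X" for n unfolding s_def using t_eq[OF X] by blast
    moreover have "x \<in> range (s X)" if x: "x \<in> X" for x
    proof -
      obtain n where n: "x \<in> B n" using cover by blast
      with x have "k n X = n" by (auto simp: k_def)
      with t_eq[OF X, of x n] x n have "s X n = x" by (simp add: s_def)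
      then show ?thesis by blast
    qed
    ultimately show "range (s X) = X" by auto
  qed
qed

section \<open>Embeddings and isometries\<close>

text \<open>The flag switches from embeddings to surjective isometries, so that both halves of the
  theorem are treated at once.\<close>

definition dist_rel ::
    "bool \<Rightarrow> 'a set \<Rightarrow> ('a \<Rightarrow> 'a \<Rightarrow> real) \<Rightarrow> 'b set \<Rightarrow> ('b \<Rightarrow> 'b \<Rightarrow> real) \<Rightarrow> bool" where
  "dist_rel b A \<rho> B \<sigma> \<longleftrightarrow>
     (\<exists>f. f ` A \<subseteq> B \<and> (b \<longrightarrow> f ` A = B) \<and> (\<forall>x\<in>A. \<forall>y\<in>A. \<sigma> (f x) (f y) = \<rho> x y))"

definition metric_rel :: "bool \<Rightarrow> 'a::metric_space set \<Rightarrow> 'b::metric_space set \<Rightarrow> bool" where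
  "metric_rel b X Y = dist_rel b X dist Y dist"

text \<open>A distance-preserving map is injective, so surjectivity already makes it a
  bijection.\<close>

lemma metric_rel_True: "metric_rel True = isometric"
proof -
  have "inj_on f X" if "\<forall>x\<in>X. \<forall>y\<in>X. dist (f x) (f y) = dist x y" for f :: "'a \<Rightarrow> 'a" and X
    using that by (auto simp: inj_on_def) (metis dist_eq_0_iff)
  then show ?thesis
    unfolding metric_rel_def dist_rel_def isometric_def isometry_on_def bij_betw_def fun_eq_iff
    by (metis order_refl)
qed

lemma metric_rel_False: "metric_rel False = isometrically_embeds"
  by (simp add: metric_rel_def dist_rel_def isometrically_embeds_def isometry_on_def fun_eq_iff)

lemma dist_rel_reindex_imp:
  assumes A: "bij_betw p A A'" "\<And>x y. x \<in> A \<Longrightarrow> y \<in> A \<Longrightarrow> \<rho>' (p x) (p y) = \<rho> x y"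
    and B: "bij_betw q B B'" "\<And>x y. x \<in> B \<Longrightarrow> y \<in> B \<Longrightarrow> \<sigma>' (q x) (q y) = \<sigma> x y"
    and rel: "dist_rel b A \<rho> B \<sigma>"
  shows "dist_rel b A' \<rho>' B' \<sigma>'"
proof -
  obtain f where f: "f ` A \<subseteq> B" "b \<longrightarrow> f ` A = B" "\<forall>x\<in>A. \<forall>y\<in>A. \<sigma> (f x) (f y) = \<rho> x y"
    using rel by (auto simp: dist_rel_def)
  define g where "g = inv_into A p"
  have g: "g ` A' = A" "\<And>x. x \<in> A' \<Longrightarrow> g x \<in> A" "\<And>x. x \<in> A' \<Longrightarrow> p (g x) = x"
    using bij_betw_inv_into[OF A(1)] bij_betw_inv_into_right[OF A(1)]
    by (auto simp: g_def bij_betw_def)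
  have qB: "q ` B = B'" using B(1) by (simp add: bij_betw_def)
  have im: "(q \<circ> f \<circ> g) ` A' = q ` f ` A" by (simp only: image_comp[symmetric] g(1))
  show ?thesis unfolding dist_rel_def
  proof (intro exI[of _ "q \<circ> f \<circ> g"] conjI)
    show "(q \<circ> f \<circ> g) ` A' \<subseteq> B'" unfolding im qB[symmetric] using f(1) by (rule image_mono)
    show "b \<longrightarrow> (q \<circ> f \<circ> g) ` A' = B'" unfolding im using f(2) qB by auto
    show "\<forall>x\<in>A'. \<forall>y\<in>A'. \<sigma>' ((q \<circ> f \<circ> g) x) ((q \<circ> f \<circ> g) y) = \<rho>' x y"
    proof (intro ballI)
      fix x y assume xy: "x \<in> A'" "y \<in> A'"
      have "f (g x) \<in> B" "f (g y) \<in> B" using xy g(2) f(1) by auto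
      then have "\<sigma>' (q (f (g x))) (q (f (g y))) = \<rho> (g x) (g y)"
        using B(2) f(3) xy g(2) by auto
      also have "\<dots> = \<rho>' x y" using A(2)[of "g x" "g y"] xy g by simp
      finally show "\<sigma>' ((q \<circ> f \<circ> g) x) ((q \<circ> f \<circ> g) y) = \<rho>' x y" by simp
    qed
  qed
qed

text \<open>Used to pass between a copy realized in the Urysohn space and the abstract distances
  that it realizes.\<close>

lemma dist_rel_reindex:
  assumes A: "bij_betw p A A'" "\<And>x y. x \<in> A \<Longrightarrow> y \<in> A \<Longrightarrow> \<rho>' (p x) (p y) = \<rho> x y"
    and B: "bij_betw q B B'" "\<And>x y. x \<in> B \<Longrightarrow> y \<in> B \<Longrightarrow> \<sigma>' (q x) (q y) = \<sigma> x y"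
  shows "dist_rel b A \<rho> B \<sigma> \<longleftrightarrow> dist_rel b A' \<rho>' B' \<sigma>'"
proof
  assume "dist_rel b A' \<rho>' B' \<sigma>'"
  moreover have "\<rho> (inv_into A p x) (inv_into A p y) = \<rho>' x y" if "x \<in> A'" "y \<in> A'" for x y
    using A(2)[of "inv_into A p x" "inv_into A p y"] that bij_betw_inv_into_right[OF A(1)]
      bij_betwE[OF bij_betw_inv_into[OF A(1)]] by auto
  moreover have "\<sigma> (inv_into B q x) (inv_into B q y) = \<sigma>' x y" if "x \<in> B'" "y \<in> B'" for x y
    using B(2)[of "inv_into B q x" "inv_into B q y"] that bij_betw_inv_into_right[OF B(1)]
      bij_betwE[OF bij_betw_inv_into[OF B(1)]] by auto
  ultimately show "dist_rel b A \<rho> B \<sigma>"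
    by (intro dist_rel_reindex_imp[OF bij_betw_inv_into[OF A(1)] _ bij_betw_inv_into[OF B(1)],
          where \<rho>' = \<rho> and \<sigma>' = \<sigma> and \<rho> = \<rho>' and \<sigma> = \<sigma>']) auto
next
  assume "dist_rel b A \<rho> B \<sigma>"
  with assms show "dist_rel b A' \<rho>' B' \<sigma>'"
    by (intro dist_rel_reindex_imp[where p = p and q = q and \<rho>' = \<rho>' and \<sigma>' = \<sigma>'
          and \<rho> = \<rho> and \<sigma> = \<sigma> and A = A and B = B]) auto
qed

text \<open>All distances compared lie in D, where \<phi> is injective, so a given map satisfies the
  same distance equations before and after rescaling.\<close>

lemma dist_rel_rescale:
  assumes "inj_on \<phi> D" "\<And>x y. x \<in> A \<Longrightarrow> y \<in> A \<Longrightarrow> \<rho> x y \<in> D"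
    "\<And>x y. x \<in> B \<Longrightarrow> y \<in> B \<Longrightarrow> \<sigma> x y \<in> D"
  shows "dist_rel b A (\<lambda>x y. \<phi> (\<rho> x y)) B (\<lambda>x y. \<phi> (\<sigma> x y)) \<longleftrightarrow> dist_rel b A \<rho> B \<sigma>"
proof -
  have "\<phi> (\<sigma> (f x) (f y)) = \<phi> (\<rho> x y) \<longleftrightarrow> \<sigma> (f x) (f y) = \<rho> x y"
    if "f ` A \<subseteq> B" "x \<in> A" "y \<in> A" for f x y
  proof -
    have "f x \<in> B" "f y \<in> B" using that by auto
    then show ?thesis using that assms by (intro inj_on_eq_iff[OF assms(1)]) auto
  qed
  then show ?thesis unfolding dist_rel_def by (intro ex_cong conj_cong refl ball_cong) auto
qed

text \<open>Two points lie in the same cell iff their distance is less than r. A distance-preserving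
  map therefore sends cells into cells and distinct cells into distinct cells; conversely, maps
  between cells can be glued because all distances across cells equal r.\<close>

lemma metric_rel_partition:
  fixes C :: "'i \<Rightarrow> 'a::metric_space set" and E :: "'j \<Rightarrow> 'b::metric_space set"
  assumes r: "r > 0"
    and ne: "\<And>i. i \<in> I \<Longrightarrow> C i \<noteq> {}" "\<And>j. j \<in> J \<Longrightarrow> E j \<noteq> {}"
    and within: "\<And>i x y. i \<in> I \<Longrightarrow> x \<in> C i \<Longrightarrow> y \<in> C i \<Longrightarrow> dist x y < r"
      "\<And>j x y. j \<in> J \<Longrightarrow> x \<in> E j \<Longrightarrow> y \<in> E j \<Longrightarrow> dist x y < r"
    and across: "\<And>i i' x y. i \<in> I \<Longrightarrow> i' \<in> I \<Longrightarrow> i \<noteq> i' \<Longrightarrow> x \<in> C i \<Longrightarrow> y \<in> C i' \<Longrightarrow> dist x y = r"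
      "\<And>j j' x y. j \<in> J \<Longrightarrow> j' \<in> J \<Longrightarrow> j \<noteq> j' \<Longrightarrow> x \<in> E j \<Longrightarrow> y \<in> E j' \<Longrightarrow> dist x y = r"
  shows "metric_rel b (\<Union>i\<in>I. C i) (\<Union>j\<in>J. E j) \<longleftrightarrow>
    (\<exists>\<pi>. inj_on \<pi> I \<and> \<pi> ` I \<subseteq> J \<and> (b \<longrightarrow> \<pi> ` I = J) \<and> (\<forall>i\<in>I. metric_rel b (C i) (E (\<pi> i))))"
    (is "?lhs \<longleftrightarrow> ?rhs")
proof
  assume ?lhs
  then obtain f where "f ` (\<Union>i\<in>I. C i) \<subseteq> (\<Union>j\<in>J. E j) \<and>
      (b \<longrightarrow> f ` (\<Union>i\<in>I. C i) = (\<Union>j\<in>J. E j)) \<and>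
      (\<forall>x\<in>\<Union>i\<in>I. C i. \<forall>y\<in>\<Union>i\<in>I. C i. dist (f x) (f y) = dist x y)"
    unfolding metric_rel_def dist_rel_def by (rule exE)
  note f0 = conjunct1[OF this] conjunct1[OF conjunct2[OF this]] conjunct2[OF conjunct2[OF this]]
  have f: "f x \<in> (\<Union>j\<in>J. E j)" if "i \<in> I" "x \<in> C i" for i x using f0(1) that by fast
  have f_surj: "\<exists>i\<in>I. \<exists>x\<in>C i. y = f x" if b "j \<in> J" "y \<in> E j" for j y
    using f0(2) that by fast
  have f_dist: "dist (f x) (f y) = dist x y" if "i \<in> I" "x \<in> C i" "i' \<in> I" "y \<in> C i'" for x y i i'
    using f0(3) that by fast
  have "\<exists>j\<in>J. f ` C i \<subseteq> E j" if i: "i \<in> I" for i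
  proof -
    obtain x where x: "x \<in> C i" using ne(1)[OF i] by auto
    then obtain j where j: "j \<in> J" "f x \<in> E j" using f[OF i x] by blast
    have "f y \<in> E j" if y: "y \<in> C i" for y
    proof -
      obtain j' where j': "j' \<in> J" "f y \<in> E j'" using f[OF i y] by blast
      have "dist (f x) (f y) < r" using f_dist[OF i x i y] within(1)[OF i x y] by simp
      then have "j = j'" using across(2)[OF j(1) j'(1) _ j(2) j'(2)] by auto
      with j' show ?thesis by simp
    qed
    with j show ?thesis by blast
  qed
  then obtain \<pi> where \<pi>: "\<And>i. i \<in> I \<Longrightarrow> \<pi> i \<in> J" "\<And>i. i \<in> I \<Longrightarrow> f ` C i \<subseteq> E (\<pi> i)" by metis
  have inj: "inj_on \<pi> I"
  proof (rule inj_onI, rule ccontr)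
    fix i i' assume i: "i \<in> I" "i' \<in> I" "\<pi> i = \<pi> i'" "i \<noteq> i'"
    obtain x y where xy: "x \<in> C i" "y \<in> C i'" using ne(1)[OF i(1)] ne(1)[OF i(2)] by auto
    then have "dist (f x) (f y) = r" using f_dist[OF i(1) xy(1) i(2) xy(2)] across(1)[OF i(1,2,4)] by simp
    moreover have "f x \<in> E (\<pi> i)" "f y \<in> E (\<pi> i)" using \<pi>(2) i xy by (metis image_subset_iff)+
    then have "dist (f x) (f y) < r" using within(2)[OF \<pi>(1)[OF i(1)]] by blast
    ultimately show False by simp
  qed
  \<comment> \<open>If \<open>f x\<close> lay in two cells, its distance to itself would be r >
    0.\<close>
  have cell: "j = \<pi> i" if "i \<in> I" "x \<in> C i" "j \<in> J" "f x \<in> E j" for i x j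
    using across(2)[OF that(3) \<pi>(1)[OF that(1)] _ that(4), of "f x"] \<pi>(2)[OF that(1)] that(2) r
    by auto
  have "\<pi> ` I = J" if b
  proof -
    have "j \<in> \<pi> ` I" if j: "j \<in> J" for j
    proof -
      obtain y where y: "y \<in> E j" using ne(2)[OF j] by auto
      then obtain i x where "i \<in> I" "x \<in> C i" "y = f x" using f_surj[OF \<open>b\<close> j] by blast
      with cell j y show ?thesis by blast
    qed
    with \<pi>(1) show ?thesis by auto
  qed
  moreover have "metric_rel b (C i) (E (\<pi> i))" if i: "i \<in> I" for i
  proof -
    have "y \<in> f ` C i" if "b" and y: "y \<in> E (\<pi> i)" for y
    proof -
      obtain i' x where x: "i' \<in> I" "x \<in> C i'" "y = f x"
        using f_surj[OF \<open>b\<close> \<pi>(1)[OF i] y] by blast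
      then have "\<pi> i = \<pi> i'" using cell \<pi>(1) i y by blast
      then have "i = i'" using inj i x by (auto dest: inj_onD)
      with x show ?thesis by auto
    qed
    then have "b \<longrightarrow> f ` C i = E (\<pi> i)" using \<pi>(2)[OF i] by auto
    then show ?thesis
      unfolding metric_rel_def dist_rel_def using \<pi>(2)[OF i] f_dist i by (intro exI[of _ f]) auto
  qed
  ultimately show ?rhs using inj \<pi>(1) by (intro exI[of _ \<pi>]) blast
next
  assume ?rhs
  then obtain \<pi> where \<pi>: "inj_on \<pi> I" "\<And>i. i \<in> I \<Longrightarrow> \<pi> i \<in> J" "b \<Longrightarrow> \<pi> ` I = J"
    and rel: "\<forall>i\<in>I. metric_rel b (C i) (E (\<pi> i))" by blast
  from rel obtain F where F0: "\<forall>i\<in>I. F i ` C i \<subseteq> E (\<pi> i) \<and> (b \<longrightarrow> F i ` C i = E (\<pi> i)) \<and>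
      (\<forall>x\<in>C i. \<forall>y\<in>C i. dist (F i x) (F i y) = dist x y)"
    unfolding metric_rel_def dist_rel_def bchoice_iff by (rule exE)
  then have F: "\<And>i. i \<in> I \<Longrightarrow> F i ` C i \<subseteq> E (\<pi> i)"
      "\<And>i. i \<in> I \<Longrightarrow> b \<Longrightarrow> F i ` C i = E (\<pi> i)"
      "\<And>i x y. i \<in> I \<Longrightarrow> x \<in> C i \<Longrightarrow> y \<in> C i \<Longrightarrow> dist (F i x) (F i y) = dist x y"
    by simp_all
  define idx where "idx x = (SOME i. i \<in> I \<and> x \<in> C i)" for x
  have idx: "idx x = i" if "i \<in> I" "x \<in> C i" for x i
  proof -
    have "idx x \<in> I \<and> x \<in> C (idx x)" unfolding idx_def by (rule someI[of _ i]) (use that in simp)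
    then show ?thesis using across(1)[of "idx x" i x x] that r by auto
  qed
  define f where "f x = F (idx x) x" for x
  have f: "f x = F i x" if "i \<in> I" "x \<in> C i" for x i using idx[OF that] by (simp add: f_def)
  have fE: "f x \<in> E (\<pi> i)" if "i \<in> I" "x \<in> C i" for x i
    using f[OF that] F(1)[OF that(1)] that(2) by auto
  have "dist (f x) (f y) = dist x y" if "i \<in> I" "x \<in> C i" "i' \<in> I" "y \<in> C i'" for x y i i'
  proof (cases "i = i'")
    case True
    with that show ?thesis using f F(3) by simp
  next
    case False
    then have "\<pi> i \<noteq> \<pi> i'" using \<pi>(1) that by (auto dest: inj_onD)
    then show ?thesis
      using across(2)[OF \<pi>(2)[OF that(1)] \<pi>(2)[OF that(3)] _ fE[OF that(1,2)] fE[OF that(3,4)]]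
        across(1)[OF that(1,3) False that(2,4)] by simp
  qed
  moreover have "f ` (\<Union>i\<in>I. C i) \<subseteq> (\<Union>j\<in>J. E j)" using fE \<pi>(2) by blast
  moreover have "(\<Union>j\<in>J. E j) \<subseteq> f ` (\<Union>i\<in>I. C i)" if b: b
  proof
    fix y assume "y \<in> (\<Union>j\<in>J. E j)"
    then obtain i where i: "i \<in> I" "y \<in> E (\<pi> i)" using \<pi>(3)[OF b] by auto
    then obtain x where "x \<in> C i" "y = F i x" using F(2)[OF i(1) b] by blast
    with i f have "y = f x" "x \<in> (\<Union>i\<in>I. C i)" by auto
    then show "y \<in> f ` (\<Union>i\<in>I. C i)" by (rule image_eqI)
  qed
  ultimately show ?lhs
    unfolding metric_rel_def dist_rel_def by (intro exI[of _ f]) auto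
qed

section \<open>Doubling\<close>

definition discrete_ultrametric :: "real \<Rightarrow> 'a set \<Rightarrow> ('a \<Rightarrow> 'a \<Rightarrow> real) \<Rightarrow> bool" where
  "discrete_ultrametric e A \<rho> \<longleftrightarrow> (\<forall>x\<in>A. \<forall>y\<in>A. \<rho> x y = \<rho> y x \<and> (\<rho> x y = 0 \<longleftrightarrow> x = y) \<and>
     (x \<noteq> y \<longrightarrow> e \<le> \<rho> x y) \<and> (\<forall>z\<in>A. \<rho> x z \<le> max (\<rho> x y) (\<rho> y z)))"

text \<open>The max-product with a two-point space of diameter e.\<close>

definition double :: "real \<Rightarrow> ('a \<Rightarrow> 'a \<Rightarrow> real) \<Rightarrow> 'a \<times> bool \<Rightarrow> 'a \<times> bool \<Rightarrow> real" where
  "double e \<rho> z w = max (\<rho> (fst z) (fst w)) (if snd z = snd w then 0 else e)"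

text \<open>Cancels a factor two between countable cardinals. If T is finite, elements are counted.
  If T is infinite, every countable S injects into it, and if g is onto then S is infinite too,
  hence equinumerous with T.\<close>

lemma halve_injection:
  fixes g :: "'a \<times> bool \<Rightarrow> 'b \<times> bool"
  assumes cnt: "countable S" "countable T"
    and g: "inj_on g (S \<times> UNIV)" "g ` (S \<times> UNIV) \<subseteq> T \<times> UNIV" "b \<longrightarrow> g ` (S \<times> UNIV) = T \<times> UNIV"
  shows "\<exists>k. inj_on k S \<and> k ` S \<subseteq> T \<and> (b \<longrightarrow> k ` S = T)"
proof (cases "finite T")
  case True
  then have fin: "finite (S \<times> (UNIV :: bool set))"
    using finite_imageD[OF _ g(1)] g(2) by (meson finite_SigmaI finite finite_subset)
  from fin have S: "finite S" by (auto dest: finite_cartesian_productD1)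
  have le: "card S \<le> card T"
    using card_inj_on_le[OF g(1,2)] True by (simp add: card_cartesian_product)
  show ?thesis
  proof (cases b)
    case b: True
    then have "card S = card T"
      using card_image[OF g(1)] g(3) by (simp add: card_cartesian_product)
    then show ?thesis
      using finite_same_card_bij[OF S True] by (auto simp: bij_betw_def)
  next
    case False
    then show ?thesis using card_le_inj[OF S True le] by auto
  qed
next
  case False
  have T: "bij_betw (from_nat_into T) UNIV T"
    using bij_betw_from_nat_into[OF cnt(2) False] .
  let ?k = "from_nat_into T \<circ> to_nat_on S"
  have "inj_on ?k S"
    using inj_on_to_nat_on[OF cnt(1)] T
    by (intro comp_inj_on) (auto simp: bij_betw_def intro: inj_on_subset)
  moreover have "?k ` S \<subseteq> T" using T by (auto simp: bij_betw_def)
  moreover have "?k ` S = T" if b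
  proof -
    have "infinite S"
    proof
      assume "finite S"
      then have "finite (T \<times> (UNIV :: bool set))"
        using g(3) that by (metis finite_SigmaI finite finite_imageI)
      with False show False by (auto dest: finite_cartesian_productD1)
    qed
    then show ?thesis
      using bij_betw_trans[OF to_nat_on_infinite[OF cnt(1)] T] by (auto simp: bij_betw_def)
  qed
  ultimately show ?thesis by blast
qed

text \<open>The two longest sides of an ultrametric triangle are equal, so a distance above e
  survives the replacement of one endpoint, and then of the other, by a point within e.\<close>

lemma discrete_ultrametric_isosceles:
  assumes "discrete_ultrametric e A \<rho>" "u \<in> A" "v \<in> A" "u' \<in> A" "v' \<in> A"
    and "\<rho> u u' \<le> e" "\<rho> v v' \<le> e" "\<rho> u v > e"
  shows "\<rho> u' v' = \<rho> u v"
proof -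
  have sym: "\<rho> x y = \<rho> y x" and ult: "\<rho> x z \<le> max (\<rho> x y) (\<rho> y z)"
    if "x \<in> A" "y \<in> A" "z \<in> A" for x y z
    using assms(1) that unfolding discrete_ultrametric_def by blast+
  have "\<rho> u v \<le> max (\<rho> u u') (\<rho> u' v)" "\<rho> u' v \<le> max (\<rho> u' v') (\<rho> v' v)"
    "\<rho> u' v' \<le> max (\<rho> u' u) (\<rho> u v')" "\<rho> u v' \<le> max (\<rho> u v) (\<rho> v v')"
    using ult assms(2-5) by blast+
  moreover have "\<rho> u' u = \<rho> u u'" "\<rho> v' v = \<rho> v v'" using sym assms(2-5) by blast+
  ultimately show ?thesis using assms(6-8) by (auto simp: max_def split: if_splits)
qed

text \<open>A ball of radius \<open>e\<close> has at most countably many points, at mutual distance exactly \<open>e\<close>, and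
  it determines, and is determined up to cardinality by, a ball of the double of twice its size.
  Cancelling the factor two ball by ball recovers the relation between the original spaces.\<close>

lemma dist_rel_double:
  assumes e: "e > 0" and cnt: "countable A" "countable B"
    and A: "discrete_ultrametric e A \<rho>" and B: "discrete_ultrametric e B \<sigma>"
  shows "dist_rel b (A \<times> UNIV) (double e \<rho>) (B \<times> UNIV) (double e \<sigma>) \<longleftrightarrow> dist_rel b A \<rho> B \<sigma>"
proof
  assume "dist_rel b A \<rho> B \<sigma>"
  then obtain f where f: "f ` A \<subseteq> B" "b \<longrightarrow> f ` A = B" "\<forall>x\<in>A. \<forall>y\<in>A. \<sigma> (f x) (f y) = \<rho> x y"
    by (auto simp: dist_rel_def)
  have "map_prod f id ` (A \<times> UNIV) = f ` A \<times> (UNIV :: bool set)"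
    by (simp add: map_prod_surj_on)
  with f show "dist_rel b (A \<times> UNIV) (double e \<rho>) (B \<times> UNIV) (double e \<sigma>)"
    unfolding dist_rel_def by (intro exI[of _ "map_prod f id"]) (auto simp: double_def)
next
  assume "dist_rel b (A \<times> UNIV) (double e \<rho>) (B \<times> UNIV) (double e \<sigma>)"
  then obtain g :: "'a \<times> bool \<Rightarrow> 'b \<times> bool" where
    g0: "g ` (A \<times> UNIV) \<subseteq> B \<times> UNIV \<and> (b \<longrightarrow> g ` (A \<times> UNIV) = B \<times> UNIV) \<and>
      (\<forall>z\<in>A \<times> UNIV. \<forall>w\<in>A \<times> UNIV. double e \<sigma> (g z) (g w) = double e \<rho> z w)"
    unfolding dist_rel_def by (rule exE)
  note g = conjunct1[OF g0] conjunct1[OF conjunct2[OF g0]]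
    bspec[OF bspec[OF conjunct2[OF conjunct2[OF g0]]]]
  have symA: "\<rho> x y = \<rho> y x" and zeroA: "\<rho> x y = 0 \<longleftrightarrow> x = y" and gapA: "x \<noteq> y \<Longrightarrow> e \<le> \<rho> x y"
    if "x \<in> A" "y \<in> A" for x y
    using A that unfolding discrete_ultrametric_def by blast+
  have ultA: "\<rho> x z \<le> max (\<rho> x y) (\<rho> y z)" if "x \<in> A" "y \<in> A" "z \<in> A" for x y z
    using A that unfolding discrete_ultrametric_def by blast
  have symB: "\<sigma> x y = \<sigma> y x" and zeroB: "\<sigma> x y = 0 \<longleftrightarrow> x = y" and gapB: "x \<noteq> y \<Longrightarrow> e \<le> \<sigma> x y"
    if "x \<in> B" "y \<in> B" for x y
    using B that unfolding discrete_ultrametric_def by blast+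
  have ultB: "\<sigma> x z \<le> max (\<sigma> x y) (\<sigma> y z)" if "x \<in> B" "y \<in> B" "z \<in> B" for x y z
    using B that unfolding discrete_ultrametric_def by blast
  define K where "K x = {y\<in>A. \<rho> x y \<le> e}" for x
  define L where "L x = {y\<in>B. \<sigma> x y \<le> e}" for x
  define h where "h x = fst (g (x, True))" for x
  have gB: "fst (g z) \<in> B" if "z \<in> A \<times> UNIV" for z
    using g(1) that by (metis image_subset_iff mem_Times_iff)
  have hB: "h x \<in> B" if "x \<in> A" for x using gB[of "(x, True)"] that by (simp add: h_def)
  have inj: "inj_on g (A \<times> UNIV)"
  proof (rule inj_onI)
    fix z w assume zw: "z \<in> A \<times> (UNIV :: bool set)" "w \<in> A \<times> UNIV" "g z = g w"
    obtain y c where y: "g w = (y, c)" "y \<in> B" using g(1) zw(2) by (metis SigmaE image_subset_iff)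
    then have "double e \<rho> z w = 0" using g(3)[OF zw(1,2)] zw(3) zeroB[of y y] by (simp add: double_def)
    moreover obtain x a x' a' where "z = (x, a)" "x \<in> A" "w = (x', a')" "x' \<in> A" using zw(1,2) by auto
    ultimately show "z = w"
      using e gapA[of x x'] by (cases "x = x'") (auto simp: double_def max_def split: if_splits)
  qed
  \<comment> \<open>Since g preserves whether a distance is at most e, it maps the double of the
    ball \<open>K x\<close> into, or if b holds onto, the double of \<open>L (h x)\<close>.\<close>
  have ball: "\<exists>k. inj_on k (K x) \<and> k ` K x \<subseteq> L (h x) \<and> (b \<longrightarrow> k ` K x = L (h x))" if x: "x \<in> A" for x
  proof (rule halve_injection)
    show "countable (K x)" "countable (L (h x))"
      unfolding K_def L_def using cnt by (auto intro: countable_subset)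
    show "inj_on g (K x \<times> UNIV)" using inj by (rule inj_on_subset) (auto simp: K_def)
    have close: "fst (g z) \<in> L (h x) \<longleftrightarrow> fst z \<in> K x" if z: "z \<in> A \<times> UNIV" for z
    proof -
      have "double e \<sigma> (g (x, True)) (g z) = double e \<rho> (x, True) z" using g(3) x z by simp
      moreover have "fst (g z) \<in> B" using gB z .
      ultimately show ?thesis
        using z e by (auto simp: double_def L_def K_def h_def max_def split: if_splits)
    qed
    show sub: "g ` (K x \<times> UNIV) \<subseteq> L (h x) \<times> UNIV"
    proof
      fix p assume "p \<in> g ` (K x \<times> UNIV)"
      then obtain z where z: "z \<in> K x \<times> UNIV" "p = g z" by blast
      then show "p \<in> L (h x) \<times> UNIV" using close[of z] by (auto simp: K_def mem_Times_iff)
    qed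
    show "b \<longrightarrow> g ` (K x \<times> UNIV) = L (h x) \<times> UNIV"
    proof (intro impI equalityI sub subsetI)
      fix p :: "'b \<times> bool" assume b and p: "p \<in> L (h x) \<times> UNIV"
      then have "p \<in> g ` (A \<times> UNIV)" using g(2) by (simp add: L_def mem_Times_iff)
      then obtain z where z: "z \<in> A \<times> UNIV" "p = g z" by blast
      then have "z \<in> K x \<times> UNIV" using close[of z] p by (simp add: mem_Times_iff)
      with z show "p \<in> g ` (K x \<times> UNIV)" by blast
    qed
  qed
  then obtain k where k: "\<And>x. x \<in> A \<Longrightarrow> inj_on (k x) (K x)" "\<And>x. x \<in> A \<Longrightarrow> k x ` K x \<subseteq> L (h x)"
      "\<And>x. x \<in> A \<Longrightarrow> b \<Longrightarrow> k x ` K x = L (h x)" by metis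
  have K_self: "x \<in> K x" if "x \<in> A" for x using that e zeroA[of x x] by (simp add: K_def)
  have K_eq: "K x = K y" if "x \<in> A" "y \<in> A" "\<rho> x y \<le> e" for x y
  proof (intro set_eqI)
    fix z
    show "z \<in> K x \<longleftrightarrow> z \<in> K y"
    proof (cases "z \<in> A")
      case True
      then show ?thesis
        using that symA[of x y] ultA[of x y z] ultA[of y x z] by (auto simp: K_def)
    qed (simp add: K_def)
  qed
  \<comment> \<open>The choice depends only on the set \<open>K x\<close>, so all points of a ball
    share one representative and hence one map \<open>k (rep x)\<close>.\<close>
  define rep where "rep x = (SOME y. y \<in> K x)" for x
  have rep: "rep x \<in> A" "\<rho> x (rep x) \<le> e" "K (rep x) = K x" if "x \<in> A" for x
  proof -
    have "rep x \<in> K x" unfolding rep_def by (rule someI[of _ x]) (rule K_self[OF that])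
    then show "rep x \<in> A" "\<rho> x (rep x) \<le> e" by (auto simp: K_def)
    then show "K (rep x) = K x" using K_eq[of x "rep x"] that by simp
  qed
  define f where "f x = k (rep x) x" for x
  have fL: "f x \<in> L (h (rep x))" if "x \<in> A" for x
    unfolding f_def using k(2)[OF rep(1)[OF that]] rep(3)[OF that] K_self[OF that] by blast
  then have fB: "f x \<in> B" if "x \<in> A" for x using that by (simp add: L_def)
  \<comment> \<open>Within a ball of radius e distinct points are at distance exactly e in both
    spaces, so injectivity of \<open>k\<close> suffices. A larger distance is carried over by g at
    the representatives and passed on to the points themselves by the isosceles property.\<close>
  have "\<sigma> (f x) (f y) = \<rho> x y" if xy: "x \<in> A" "y \<in> A" for x y
  proof (cases "\<rho> x y \<le> e")
    case True
    then have "K x = K y" using K_eq xy by blast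
    then have same: "rep x = rep y" by (simp add: rep_def)
    show ?thesis
    proof (cases "x = y")
      case True
      then show ?thesis using zeroA[of x x] zeroB[of "f x" "f x"] fB xy by simp
    next
      case False
      have "f x \<noteq> f y"
        unfolding f_def same
        using False k(1)[OF rep(1)[OF xy(2)]] rep(3)[OF xy(2)] K_self xy \<open>K x = K y\<close>
        by (auto dest: inj_onD)
      then have "e \<le> \<sigma> (f x) (f y)" using gapB fB xy by blast
      moreover have "\<sigma> (f x) (f y) \<le> e"
        using fL[OF xy(1)] fL[OF xy(2)] ultB[of "f x" "h (rep y)" "f y"] symB[of "f x" "h (rep y)"]
          hB[OF rep(1)[OF xy(2)]] by (auto simp: L_def same)
      ultimately show ?thesis using gapA[OF xy False] True by simp
    qed
  next
    case False
    have r: "rep x \<in> A" "rep y \<in> A" using rep(1) xy by auto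
    have "\<rho> (rep x) (rep y) = \<rho> x y"
      using discrete_ultrametric_isosceles[OF A xy r rep(2)[OF xy(1)] rep(2)[OF xy(2)]] False by simp
    moreover have "double e \<sigma> (g (rep x, True)) (g (rep y, True)) = double e \<rho> (rep x, True) (rep y, True)"
      using g(3) r by simp
    ultimately have h: "\<sigma> (h (rep x)) (h (rep y)) = \<rho> x y"
      using False e by (auto simp: double_def h_def max_def split: if_splits)
    then show ?thesis
      using discrete_ultrametric_isosceles[OF B hB[OF r(1)] hB[OF r(2)] fB[OF xy(1)] fB[OF xy(2)]]
        fL[OF xy(1)] fL[OF xy(2)] False by (simp add: L_def)
  qed
  moreover have "B \<subseteq> f ` A" if b
  proof
    \<comment> \<open>A preimage of \<open>(y, True)\<close> under g tells which ball of A is mapped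
      to the ball of y; the map \<open>k\<close> of that ball then hits y.\<close>
    fix y assume y: "y \<in> B"
    then have "(y, True) \<in> g ` (A \<times> UNIV)" using g(2) that by auto
    then obtain x a where x: "x \<in> A" "g (x, a) = (y, True)" by auto
    note r = rep[OF x(1)]
    have "double e \<sigma> (g (rep x, True)) (g (x, a)) = double e \<rho> (rep x, True) (x, a)"
      using g(3)[of "(rep x, True)" "(x, a)"] x(1) r(1) by simp
    then have "\<sigma> (h (rep x)) y \<le> e"
      using x(2) r(2) symA[OF x(1) r(1)] e by (auto simp: double_def h_def max_def split: if_splits)
    then have "y \<in> k (rep x) ` K (rep x)" using k(3)[OF r(1) that] y by (simp add: L_def)
    then obtain w where w: "w \<in> K (rep x)" "y = k (rep x) w" by blast
    then have "w \<in> A" "\<rho> (rep x) w \<le> e" by (auto simp: K_def)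
    then have "rep w = rep x" using K_eq[OF r(1)] r(3) by (simp add: rep_def)
    with w have "y = f w" by (simp add: f_def)
    with \<open>w \<in> A\<close> show "y \<in> f ` A" by blast
  qed
  moreover have "f ` A \<subseteq> B" using fB by blast
  ultimately show "dist_rel b A \<rho> B \<sigma>"
    unfolding dist_rel_def by (intro exI[of _ f]) blast
qed

section \<open>Powers\<close>

text \<open>Both complements are countably infinite, so any bijection between them completes the
  given injection. It will match the padding terms.\<close>

lemma bij_extend:
  fixes \<pi> :: "nat \<Rightarrow> nat"
  assumes "inj_on \<pi> A" "infinite (- A)" "infinite (- (\<pi> ` A))"
  shows "\<exists>\<sigma>. bij \<sigma> \<and> (\<forall>i\<in>A. \<sigma> i = \<pi> i)"
proof -
  define \<tau> where "\<tau> = from_nat_into (- (\<pi> ` A)) \<circ> to_nat_on (- A)"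
  define \<sigma> where "\<sigma> i = (if i \<in> A then \<pi> i else \<tau> i)" for i
  have "bij_betw \<tau> (- A) (- (\<pi> ` A))"
    unfolding \<tau>_def
    by (rule bij_betw_trans[OF to_nat_on_infinite[OF _ assms(2)] bij_betw_from_nat_into[OF _ assms(3)]])
      simp_all
  then have "bij_betw \<sigma> (- A) (- (\<pi> ` A))" by (rule bij_betw_cong[THEN iffD1, rotated]) (simp add: \<sigma>_def)
  moreover have "bij_betw \<sigma> A (\<pi> ` A)"
    using assms(1) by (subst bij_betw_cong[of _ _ \<pi>]) (auto simp: \<sigma>_def bij_betw_def)
  ultimately have "bij_betw \<sigma> (A \<union> - A) (\<pi> ` A \<union> - (\<pi> ` A))"
    by (intro bij_betw_combine) auto
  then show ?thesis by (intro exI[of _ \<sigma>]) (simp add: \<sigma>_def)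
qed

text \<open>The two injections respect the classes of S, so the Schroeder-Bernstein theorem can be
  applied class by class and the resulting bijections united.\<close>

lemma qo_equiv_inj_power:
  assumes "equivp S"
  shows "qo_equiv (inj_power S) x y \<longleftrightarrow> (\<exists>\<pi>. bij \<pi> \<and> (\<forall>n. S (x n) (y (\<pi> n))))"
proof
  assume "qo_equiv (inj_power S) x y"
  then obtain f g where f: "inj f" "\<And>n. S (x n) (y (f n))" and g: "inj g" "\<And>n. S (y n) (x (g n))"
    by (auto simp: qo_equiv_def inj_power_def)
  have sym: "S u v \<Longrightarrow> S v u" and tr: "S u v \<Longrightarrow> S v w \<Longrightarrow> S u w" for u v w
    using equivp_symp[OF assms] equivp_transp[OF assms] by blast+
  have "\<exists>h. bij_betw h {n. S c (x n)} {n. S c (y n)}" for c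
  proof (rule Schroeder_Bernstein[where f = f and g = g])
    show "f ` {n. S c (x n)} \<subseteq> {n. S c (y n)}" "g ` {n. S c (y n)} \<subseteq> {n. S c (x n)}"
      using f(2) g(2) tr by blast+
  qed (use f g in \<open>auto intro: inj_on_subset\<close>)
  \<comment> \<open>The bijections are chosen for classes, not for representatives, so that
    equivalent terms are treated by the same one.\<close>
  then have "\<forall>P. \<exists>h. P \<in> range S \<longrightarrow> bij_betw h {n. P (x n)} {n. P (y n)}" by blast
  then obtain H where H: "\<And>c. bij_betw (H (S c)) {n. S c (x n)} {n. S c (y n)}" by (metis rangeI)
  define \<pi> where "\<pi> n = H (S (x n)) n" for n
  have cls: "S u = S v" if "S u v" for u v using that assms by (simp add: equivp_def)
  have \<pi>: "S (x n) (y (\<pi> n))" for n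
    using bij_betwE[OF H[of "x n"]] equivp_reflp[OF assms] by (auto simp: \<pi>_def)
  have "inj \<pi>"
  proof (rule injI)
    fix n m assume eq: "\<pi> n = \<pi> m"
    then have "S (x n) (x m)" using \<pi>[of n] \<pi>[of m] sym tr by metis
    then show "n = m"
      using eq cls[of "x n" "x m"] inj_onD[OF bij_betw_imp_inj_on[OF H[of "x n"]], of n m]
        equivp_reflp[OF assms, of "x n"] by (simp add: \<pi>_def)
  qed
  moreover have "m \<in> range \<pi>" for m
  proof -
    have "m \<in> H (S (y m)) ` {n. S (y m) (x n)}"
      using H[of "y m"] equivp_reflp[OF assms] by (auto simp: bij_betw_def)
    then obtain n where "S (y m) (x n)" "m = H (S (y m)) n" by auto
    then show ?thesis using cls[of "y m" "x n"] by (auto simp: \<pi>_def)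
  qed
  ultimately show "\<exists>\<pi>. bij \<pi> \<and> (\<forall>n. S (x n) (y (\<pi> n)))"
    using \<pi> by (intro exI[of _ \<pi>]) (auto simp: bij_def)
next
  assume "\<exists>\<pi>. bij \<pi> \<and> (\<forall>n. S (x n) (y (\<pi> n)))"
  then obtain \<pi> where \<pi>: "bij \<pi>" "\<And>n. S (x n) (y (\<pi> n))" by blast
  have "S (y n) (x (inv \<pi> n))" for n
    using \<pi>(2)[of "inv \<pi> n"] \<pi>(1) equivp_symp[OF assms] by (simp add: bij_is_surj surj_f_inv_f)
  moreover have "inj (inv \<pi>)" using \<pi>(1) by (simp add: bij_imp_bij_inv bij_is_inj)
  ultimately show "qo_equiv (inj_power S) x y"
    using \<pi> unfolding qo_equiv_def inj_power_def by (meson bij_is_inj)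
qed

lemma equivp_isometric: "equivp (isometric :: 'a::metric_space set \<Rightarrow> _)"
proof (rule equivpI)
  show "reflp (isometric :: 'a set \<Rightarrow> _)"
    by (intro reflpI) (auto simp: isometric_def isometry_on_def intro!: exI[of _ id])
  show "symp (isometric :: 'a set \<Rightarrow> _)"
  proof (rule sympI)
    fix X Y :: "'a set" assume "isometric X Y"
    then obtain f where f: "bij_betw f X Y" "isometry_on X f" by (auto simp: isometric_def)
    have "isometry_on Y (inv_into X f)"
      unfolding isometry_on_def
    proof (intro ballI)
      fix x y assume xy: "x \<in> Y" "y \<in> Y"
      then have "inv_into X f x \<in> X" "inv_into X f y \<in> X"
        using bij_betwE[OF bij_betw_inv_into[OF f(1)]] by auto
      with f xy show "dist (inv_into X f x) (inv_into X f y) = dist x y"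
        unfolding isometry_on_def by (metis bij_betw_inv_into_right)
    qed
    with bij_betw_inv_into[OF f(1)] show "isometric Y X" by (auto simp: isometric_def)
  qed
  show "transp (isometric :: 'a set \<Rightarrow> _)"
  proof (rule transpI)
    fix X Y Z :: "'a set" assume "isometric X Y" "isometric Y Z"
    then obtain f g where fg: "bij_betw f X Y" "isometry_on X f" "bij_betw g Y Z" "isometry_on Y g"
      by (auto simp: isometric_def)
    then have "isometry_on X (g \<circ> f)"
      using bij_betwE[OF fg(1)] by (auto simp: isometry_on_def)
    with bij_betw_trans[OF fg(1,3)] show "isometric X Z" by (auto simp: isometric_def)
  qed
qed

text \<open>For isometry, mutual injections amount to one bijection by
  \<open>qo_equiv_inj_power\<close>; the flag can therefore again cover both halves of the
  theorem.\<close>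

definition power_rel :: "bool \<Rightarrow> (nat \<Rightarrow> 'a::metric_space set) \<Rightarrow> (nat \<Rightarrow> 'a set) \<Rightarrow> bool" where
  "power_rel b x y \<longleftrightarrow> (\<exists>\<pi>. inj \<pi> \<and> (b \<longrightarrow> surj \<pi>) \<and> (\<forall>n. metric_rel b (x n) (y (\<pi> n))))"

lemma power_rel_True: "power_rel True = qo_equiv (inj_power isometric)"
  by (intro ext) (simp add: qo_equiv_inj_power[OF equivp_isometric] power_rel_def metric_rel_True bij_def
      conj_assoc)

lemma power_rel_False: "power_rel False = inj_power isometrically_embeds"
  by (intro ext) (simp add: power_rel_def inj_power_def metric_rel_False)

text \<open>Repetitions in the enumeration do no harm: indices of the same point have distance 0, so
  \<open>h\<close> realizes them by one point.\<close>

lemma enumeration_bij: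
  assumes X: "range s = X" and h: "\<And>i j. dist (h i) (h j) = \<rho> (s i) (s j)"
    and zero: "\<And>x y. x \<in> X \<Longrightarrow> y \<in> X \<Longrightarrow> \<rho> x y = 0 \<longleftrightarrow> x = y"
  shows "\<exists>p. bij_betw p X (range h) \<and> (\<forall>x\<in>X. \<forall>y\<in>X. dist (p x) (p y) = \<rho> x y)"
proof -
  define p where "p x = h (inv s x)" for x
  have s: "s (inv s x) = x" if "x \<in> X" for x using X that by (auto intro: f_inv_into_f)
  have dist_p: "dist (p x) (p y) = \<rho> x y" if "x \<in> X" "y \<in> X" for x y
    using that by (simp add: p_def h s)
  have "p (s i) = h i" for i
  proof -
    have si: "s i \<in> X" using X by auto
    have "dist (p (s i)) (h i) = \<rho> (s i) (s i)" by (simp add: p_def h s[OF si])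
    also have "\<dots> = 0" using zero[OF si si] by simp
    finally show ?thesis by simp
  qed
  then have "p ` X = range h" unfolding X[symmetric] by (simp add: image_image)
  moreover have "inj_on p X"
  proof (rule inj_onI)
    fix x y assume xy: "x \<in> X" "y \<in> X" "p x = p y"
    then have "\<rho> x y = 0" using dist_p[OF xy(1,2)] by simp
    then show "x = y" using zero xy by blast
  qed
  ultimately show ?thesis using dist_p by (intro exI[of _ p]) (simp add: bij_betw_def)
qed

text \<open>As D is countable, f is measurable into the discrete space D, on which every function is
  measurable.\<close>

lemma measurable_comp_countable:
  fixes f :: "'m \<Rightarrow> real" and \<phi> :: "real \<Rightarrow> real"
  assumes "f \<in> borel_measurable M" "countable D" "\<And>x. x \<in> space M \<Longrightarrow> f x \<in> D"
  shows "(\<lambda>x. \<phi> (f x)) \<in> borel_measurable M"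
proof -
  have "f \<in> M \<rightarrow>\<^sub>M count_space D"
    using assms by (subst measurable_count_space_eq_countable) (auto intro: measurable_sets)
  then show ?thesis by (rule measurable_compose) simp
qed

section \<open>From sequences to spaces\<close>

text \<open>The index (n, i) stands for the i-th point of the n-th space. Values of \<phi> stay
  below r, so the coded spaces are exactly the cells of \<open>metric_rel_partition\<close>. One
  Borel map works for both values of b.\<close>

lemma power_rel_reduction:
  assumes U: "urysohn_space TYPE('u::polish_space)" and D: "wo_distances D" "d \<in> D" "d > 0"
    and D': "wo_distances D'" and r: "r > 0" "r \<in> D'" "\<And>x. x \<in> D' \<Longrightarrow> x \<le> r"
    and \<phi>: "bij_betw \<phi> D (D' - {r})" "\<And>x y. x \<in> D \<Longrightarrow> y \<in> D \<Longrightarrow> \<phi> x \<le> \<phi> y \<longleftrightarrow> x \<le> y" "\<phi> 0 = 0"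
  shows "\<exists>F \<in> sequence_space (ultrametric_subspaces D :: 'u set measure) \<rightarrow>\<^sub>M
            (ultrametric_subspaces D' :: 'u set measure).
           \<forall>x\<in>space (sequence_space (ultrametric_subspaces D)).
           \<forall>y\<in>space (sequence_space (ultrametric_subspaces D)).
           \<forall>b. power_rel b x y \<longleftrightarrow> metric_rel b (F x) (F y)"
proof -
  let ?M = "ultrametric_subspaces D :: 'u set measure"
  let ?N = "sequence_space ?M"
  obtain s :: "'u set \<Rightarrow> nat \<Rightarrow> 'u" where s_meas: "\<And>n. (\<lambda>X. s X n) \<in> borel_measurable ?M"
    and s_range: "\<And>X. X \<in> space ?M \<Longrightarrow> range (s X) = X"
    using measurable_enumeration[OF D] by blast
  define \<delta> where "\<delta> x p q = (if fst p = fst q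
      then \<phi> (dist (s (x (fst p)) (snd p)) (s (x (fst p)) (snd q))) else r)" for x and p q :: "nat \<times> nat"
  have space_N: "x n \<in> space ?M" if "x \<in> space ?N" for x n
    using that by (auto simp: space_PiM PiE_iff)
  have s_in: "s (x n) i \<in> x n" if "x \<in> space ?N" for x n i
    using s_range[OF space_N[OF that, of n]] by blast
  have inD: "dist u v \<in> D" if "x \<in> space ?N" "u \<in> x n" "v \<in> x n" for x n u v
    using space_N[OF that(1), of n] that by (auto simp: space_ultrametric_subspaces)
  have \<phi>D': "\<phi> u \<in> D'" "\<phi> u < r" if "u \<in> D" for u
    using bij_betwE[OF \<phi>(1)] that r(3)[of "\<phi> u"] by force+
  have \<phi>inj: "inj_on \<phi> D" using \<phi>(1) by (simp add: bij_betw_def)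
  have "0 \<in> D" using D(1) by (simp add: wo_distances_def)
  have zero: "\<phi> (dist u v) = 0 \<longleftrightarrow> u = v" if "x \<in> space ?N" "u \<in> x n" "v \<in> x n" for x n u v
    using inj_on_eq_iff[OF \<phi>inj inD[OF that] \<open>0 \<in> D\<close>] \<phi>(3) by simp
  have \<delta>: "pseudo_ultrametric D' (\<delta> x)" if x: "x \<in> space ?N" for x
    unfolding pseudo_ultrametric_def
  proof (intro conjI allI)
    fix p q t :: "nat \<times> nat"
    show "\<delta> x p p = 0" by (simp add: \<delta>_def \<phi>(3))
    show "\<delta> x p q = \<delta> x q p" by (simp add: \<delta>_def dist_commute)
    have small: "\<phi> (dist (s (x n) i) (s (x n) j)) \<in> D'" "\<phi> (dist (s (x n) i) (s (x n) j)) \<le> r" for n i j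
      using \<phi>D'[OF inD[OF x s_in[OF x] s_in[OF x]]] by (auto intro: less_imp_le)
    then show "\<delta> x p q \<in> D'" using r(2) by (simp add: \<delta>_def)
    show "\<delta> x p t \<le> max (\<delta> x p q) (\<delta> x q t)"
    proof (cases "fst p = fst q \<and> fst q = fst t")
      case True
      let ?u = "s (x (fst p)) (snd p)" and ?v = "s (x (fst p)) (snd q)" and ?w = "s (x (fst p)) (snd t)"
      have "dist ?u ?w \<le> max (dist ?u ?v) (dist ?v ?w)"
        using space_N[OF x, of "fst p"] s_in[OF x, of "fst p"]
        unfolding space_ultrametric_subspaces ultrametric_on_def by blast
      then have "\<phi> (dist ?u ?w) \<le> max (\<phi> (dist ?u ?v)) (\<phi> (dist ?v ?w))"
        using \<phi>(2) inD[OF x s_in[OF x] s_in[OF x]] by (simp add: le_max_iff_disj)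
      with True show ?thesis by (simp add: \<delta>_def)
    next
      case False
      \<comment> \<open>If p, q, t are not all in one block, then one of the two steps changes the
        block and has length r, the largest distance.\<close>
      have "\<delta> x p t \<le> r" using small by (simp add: \<delta>_def)
      moreover have "\<delta> x p q = r \<or> \<delta> x q t = r" using False by (auto simp: \<delta>_def)
      ultimately show ?thesis by auto
    qed
  qed
  have meas: "(\<lambda>x. \<delta> x p q) \<in> borel_measurable ?N" for p q
  proof (cases "fst p = fst q")
    case True
    have [measurable]: "(\<lambda>x. s (x n) i) \<in> borel_measurable ?N" for n i
      by (rule measurable_compose[OF _ s_meas, of "\<lambda>x. x n"]) simp
    have "(\<lambda>x. dist (s (x (fst p)) (snd p)) (s (x (fst p)) (snd q))) \<in> borel_measurable ?N"
      by measurable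
    then have "(\<lambda>x. \<phi> (dist (s (x (fst p)) (snd p)) (s (x (fst p)) (snd q)))) \<in> borel_measurable ?N"
      by (rule measurable_comp_countable[of _ _ D]) (use D(1) in \<open>simp add: wo_distances_def\<close>, rule inD[OF _ s_in s_in])
    with True show ?thesis by (simp add: \<delta>_def)
  qed (simp add: \<delta>_def)
  obtain h :: "(nat \<Rightarrow> 'u set) \<Rightarrow> nat \<times> nat \<Rightarrow> 'u"
    where h: "\<And>x p q. x \<in> space ?N \<Longrightarrow> dist (h x p) (h x q) = \<delta> x p q"
      and h_meas: "(\<lambda>x. range (h x)) \<in> ?N \<rightarrow>\<^sub>M (ultrametric_subspaces D' :: 'u set measure)"
    using measurable_realization[OF U D' r(2,1) \<delta> meas] by blast
  define C where "C x n = range (\<lambda>i. h x (n, i))" for x n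
  have range_h: "range (h x) = (\<Union>n\<in>UNIV. C x n)" for x
    by (auto simp: C_def)
  have C_bij: "\<exists>p. bij_betw p (x n) (C x n) \<and> (\<forall>u\<in>x n. \<forall>v\<in>x n. dist (p u) (p v) = \<phi> (dist u v))"
    if x: "x \<in> space ?N" for x n
    unfolding C_def using zero[OF x] h[OF x]
    by (intro enumeration_bij[OF s_range[OF space_N[OF x]], where \<rho> = "\<lambda>u v. \<phi> (dist u v)"])
      (auto simp: \<delta>_def)
  have C_rel: "metric_rel b (C x n) (C y m) \<longleftrightarrow> metric_rel b (x n) (y m)"
    if xy: "x \<in> space ?N" "y \<in> space ?N" for b x y n m
  proof -
    obtain p q where p: "bij_betw p (x n) (C x n)" "\<forall>u\<in>x n. \<forall>v\<in>x n. dist (p u) (p v) = \<phi> (dist u v)"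
      and q: "bij_betw q (y m) (C y m)" "\<forall>u\<in>y m. \<forall>v\<in>y m. dist (q u) (q v) = \<phi> (dist u v)"
      using C_bij xy by meson
    have "metric_rel b (C x n) (C y m) \<longleftrightarrow>
        dist_rel b (x n) (\<lambda>u v. \<phi> (dist u v)) (y m) (\<lambda>u v. \<phi> (dist u v))"
      unfolding metric_rel_def using p q by (intro dist_rel_reindex[symmetric, of p _ _ _ _ q]) auto
    also have "\<dots> \<longleftrightarrow> metric_rel b (x n) (y m)"
      unfolding metric_rel_def using inD xy by (intro dist_rel_rescale[OF \<phi>inj]) auto
    finally show ?thesis .
  qed
  have C_within: "dist u v < r" if "x \<in> space ?N" "u \<in> C x n" "v \<in> C x n" for x n u v
    using that \<phi>D'(2)[OF inD[OF that(1) s_in[OF that(1)] s_in[OF that(1)]]]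
    by (auto simp: C_def h \<delta>_def)
  have C_across: "dist u v = r" if "x \<in> space ?N" "n \<noteq> m" "u \<in> C x n" "v \<in> C x m" for x n m u v
    using that by (auto simp: C_def h \<delta>_def)
  have "power_rel b x y \<longleftrightarrow> metric_rel b (range (h x)) (range (h y))"
    if xy: "x \<in> space ?N" "y \<in> space ?N" for b x y
  proof -
    have ne: "C x n \<noteq> {}" for x n by (simp add: C_def)
    have "metric_rel b (range (h x)) (range (h y)) \<longleftrightarrow>
        (\<exists>\<pi>. inj \<pi> \<and> range \<pi> \<subseteq> UNIV \<and> (b \<longrightarrow> surj \<pi>) \<and> (\<forall>n\<in>UNIV. metric_rel b (C x n) (C y (\<pi> n))))"
      unfolding range_h
      by (rule metric_rel_partition[OF r(1) ne ne C_within[OF xy(1)] C_within[OF xy(2)]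
            C_across[OF xy(1)] C_across[OF xy(2)]])
    then show ?thesis by (simp add: power_rel_def C_rel[OF xy])
  qed
  with h_meas show ?thesis by (intro bexI[of _ "\<lambda>x. range (h x)"]) auto
qed

section \<open>From spaces to sequences\<close>

text \<open>Handles padding terms: for embeddings they may be sent to any term, for isometries the
  target must be a singleton as well.\<close>

lemma metric_rel_singleton:
  assumes "S \<noteq> {}" "b \<Longrightarrow> \<exists>y. S = {y}"
  shows "metric_rel b {x} S"
proof (cases b)
  case True
  with assms(2) obtain y where "S = {y}" by auto
  then show ?thesis unfolding metric_rel_def dist_rel_def by (intro exI[of _ "\<lambda>_. y"]) auto
next
  case False
  obtain y where "y \<in> S" using assms(1) by auto
  with False show ?thesis unfolding metric_rel_def dist_rel_def by (intro exI[of _ "\<lambda>_. y"]) auto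
qed

text \<open>Keeps doubled balls, which have at least two points, from being sent to padding.\<close>

lemma metric_rel_into_singleton:
  assumes "metric_rel b X {y}" "u \<in> X" "v \<in> X"
  shows "u = v"
  using assms unfolding metric_rel_def dist_rel_def
  by (metis dist_eq_0_iff image_subset_iff singletonD)

lemma metric_rel_from_singleton:
  assumes "metric_rel True {x} Y" "u \<in> Y" "v \<in> Y"
  shows "u = v"
  using assms unfolding metric_rel_def dist_rel_def by auto

text \<open>A position that starts a new ball carries the double of that ball, every other position
  a singleton. As there are infinitely many singletons for every X, an injection between balls
  extends to a bijection of positions; conversely, relations between the sequences send doubled
  balls to doubled balls.\<close>

lemma metric_rel_reduction:
  assumes U: "urysohn_space TYPE('u::polish_space)" and D: "wo_distances D" "d \<in> D" "d > 0"
    and D': "wo_distances D'" and r: "r > 0" "r \<in> D'" "\<And>x. x \<in> D' \<Longrightarrow> x \<le> r"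
    and \<psi>: "bij_betw \<psi> (D' - {r}) D"
      "\<And>x y. x \<in> D' - {r} \<Longrightarrow> y \<in> D' - {r} \<Longrightarrow> \<psi> x \<le> \<psi> y \<longleftrightarrow> x \<le> y" "\<psi> 0 = 0"
  shows "\<exists>F \<in> (ultrametric_subspaces D' :: 'u set measure) \<rightarrow>\<^sub>M
            sequence_space (ultrametric_subspaces D :: 'u set measure).
           \<forall>X\<in>space (ultrametric_subspaces D'). \<forall>Y\<in>space (ultrametric_subspaces D').
           \<forall>b. metric_rel b X Y \<longleftrightarrow> power_rel b (F X) (F Y)"
proof -
  let ?M = "ultrametric_subspaces D' :: 'u set measure"
  obtain e where e: "e \<in> D" "e > 0" "\<And>x. x \<in> D \<Longrightarrow> x > 0 \<Longrightarrow> e \<le> x"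
    using wo_distances_min_pos[OF D] by blast
  obtain s :: "'u set \<Rightarrow> nat \<Rightarrow> 'u" where s_meas: "\<And>n. (\<lambda>X. s X n) \<in> borel_measurable ?M"
    and s_range: "\<And>X. X \<in> space ?M \<Longrightarrow> range (s X) = X"
    using measurable_enumeration[OF D' r(2,1)] by blast
  \<comment> \<open>Every point is listed twice, so that infinitely many indices do not start a new cell.\<close>
  define t where "t X n = s X (n div 2)" for X n
  have t_meas [measurable]: "(\<lambda>X. t X n) \<in> borel_measurable ?M" for n
    unfolding t_def by (rule s_meas)
  have t_range: "range (t X) = X" if "X \<in> space ?M" for X
  proof -
    have "s X n \<in> range (t X)" for n
      unfolding t_def by (rule range_eqI[of _ _ "2 * n"]) simp
    then have "range (s X) \<subseteq> range (t X)" by blast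
    moreover have "range (t X) \<subseteq> range (s X)" by (auto simp: t_def)
    ultimately show ?thesis using s_range[OF that] by blast
  qed
  have t_in: "t X n \<in> X" if "X \<in> space ?M" for X n using t_range[OF that] by blast
  \<comment> \<open>Selects exactly one index for each open ball of radius r.\<close>
  define first where "first X i \<longleftrightarrow> (\<forall>j<i. \<not> dist (t X j) (t X i) < r)" for X i
  \<comment> \<open>An enumeration of the ball around \<open>t X i\<close>: listed points outside it
    are replaced by the centre.\<close>
  define c where "c X i n = (if dist (t X n) (t X i) < r then t X n else t X i)" for X i n
  define A where "A X i = {x\<in>X. dist x (t X i) < r}" for X i
  define \<rho> where "\<rho> u v = \<psi> (dist u v)" for u v :: 'u
  \<comment> \<open>The zero matrix is realized by a single point; this is the padding.\<close>
  define \<delta> where "\<delta> i X p q = (if first X i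
      then double e \<rho> (c X i (fst p), snd p) (c X i (fst q), snd q) else 0)" for i X and p q :: "nat \<times> bool"

  have inD': "dist u v \<in> D'" if "X \<in> space ?M" "u \<in> X" "v \<in> X" for X u v
    using that by (auto simp: space_ultrametric_subspaces)
  have ult: "dist u w \<le> max (dist u v) (dist v w)"
    if "X \<in> space ?M" "u \<in> X" "v \<in> X" "w \<in> X" for X u v w
    using that unfolding space_ultrametric_subspaces ultrametric_on_def by blast
  have c_range: "range (c X i) = A X i" if X: "X \<in> space ?M" for X i
  proof
    show "range (c X i) \<subseteq> A X i" using t_in[OF X] r(1) by (auto simp: c_def A_def)
    show "A X i \<subseteq> range (c X i)"
    proof
      fix x assume x: "x \<in> A X i"
      then obtain n where "x = t X n" using t_range[OF X] by (auto simp: A_def)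
      with x have "x = c X i n" by (simp add: c_def A_def)
      then show "x \<in> range (c X i)" by blast
    qed
  qed
  then have c_in: "c X i n \<in> A X i" if "X \<in> space ?M" for X i n using that by blast
  have A_sub: "A X i \<subseteq> X" for X i by (auto simp: A_def)
  have A_within: "dist u v < r" if "X \<in> space ?M" "u \<in> A X i" "v \<in> A X i" for X i u v
    using ult[OF that(1), of u "t X i" v] that t_in[OF that(1), of i]
    by (auto simp: A_def dist_commute)
  have A_dist: "dist u v \<in> D' - {r}" if "X \<in> space ?M" "u \<in> A X i" "v \<in> A X i" for X i u v
    using inD'[OF that(1)] A_within[OF that] that A_sub by blast
  have \<psi>D: "\<psi> x \<in> D" if "x \<in> D' - {r}" for x using bij_betwE[OF \<psi>(1)] that by blast
  have \<psi>inj: "inj_on \<psi> (D' - {r})" using \<psi>(1) by (simp add: bij_betw_def)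
  have D'0: "0 \<in> D' - {r}" using D' r(1) by (auto simp: wo_distances_def)
  have nonneg: "x \<ge> 0" if "x \<in> D" for x using D(1) that by (auto simp: wo_distances_def)
  have A_ultra: "discrete_ultrametric e (A X i) \<rho>" if X: "X \<in> space ?M" for X i
    unfolding discrete_ultrametric_def
  proof (intro ballI conjI impI)
    fix x y z assume xyz: "x \<in> A X i" "y \<in> A X i" "z \<in> A X i"
    show "\<rho> x y = \<rho> y x" by (simp add: \<rho>_def dist_commute)
    show zero: "\<rho> x y = 0 \<longleftrightarrow> x = y"
      using inj_on_eq_iff[OF \<psi>inj A_dist[OF X xyz(1,2)] D'0] \<psi>(3) by (simp add: \<rho>_def)
    have "\<rho> x y \<in> D" unfolding \<rho>_def by (rule \<psi>D[OF A_dist[OF X xyz(1,2)]])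
    then show "e \<le> \<rho> x y" if "x \<noteq> y"
      using zero that nonneg[of "\<rho> x y"] e(3)[of "\<rho> x y"] by simp
    have "dist x z \<le> max (dist x y) (dist y z)" using ult[OF X] xyz A_sub by blast
    then show "\<rho> x z \<le> max (\<rho> x y) (\<rho> y z)"
      using \<psi>(2)[OF A_dist[OF X xyz(1,3)] A_dist[OF X xyz(1,2)]]
        \<psi>(2)[OF A_dist[OF X xyz(1,3)] A_dist[OF X xyz(2,3)]]
      by (simp add: \<rho>_def le_max_iff_disj)
  qed
  have \<delta>: "pseudo_ultrametric D (\<delta> i X)" if X: "X \<in> space ?M" for X i
  proof (cases "first X i")
    case True
    note u = A_ultra[OF X, of i, unfolded discrete_ultrametric_def]
    have c: "c X i n \<in> A X i" for n using c_in[OF X] .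
    have sym: "\<rho> (c X i n) (c X i m) = \<rho> (c X i m) (c X i n)"
      and refl: "\<rho> (c X i n) (c X i n) = 0"
      and tri: "\<rho> (c X i n) (c X i l) \<le> max (\<rho> (c X i n) (c X i m)) (\<rho> (c X i m) (c X i l))" for n m l
      using u c by blast+
    have in_D: "\<rho> (c X i n) (c X i m) \<in> D" for n m
      unfolding \<rho>_def by (rule \<psi>D[OF A_dist[OF X c c]])
    show ?thesis unfolding pseudo_ultrametric_def
    proof (intro conjI allI)
      fix p q v :: "nat \<times> bool"
      show "\<delta> i X p p = 0" using refl by (simp add: \<delta>_def double_def)
      show "\<delta> i X p q = \<delta> i X q p"
        using sym[of "fst p" "fst q"] by (cases "snd p = snd q") (simp_all add: \<delta>_def double_def)
      show "\<delta> i X p q \<in> D"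
        using in_D e(1) D(1) by (simp add: \<delta>_def double_def True max_def wo_distances_def)
      show "\<delta> i X p v \<le> max (\<delta> i X p q) (\<delta> i X q v)"
        using tri[of "fst p" "fst v" "fst q"] e(2) nonneg[OF in_D]
        by (auto simp: \<delta>_def double_def True max_def split: if_splits)
    qed
  next
    case False
    then show ?thesis using D(1) by (simp add: pseudo_ultrametric_def \<delta>_def wo_distances_def)
  qed
  have meas: "(\<lambda>X. \<delta> i X p q) \<in> borel_measurable ?M" for i p q
  proof -
    have first_meas [measurable]: "Measurable.pred ?M (\<lambda>X. first X i)"
      unfolding first_def by measurable
    have c_meas [measurable]: "(\<lambda>X. c X i n) \<in> borel_measurable ?M" for n
      unfolding c_def by measurable
    have "(\<lambda>X. dist (c X i (fst p)) (c X i (fst q))) \<in> borel_measurable ?M" by measurable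
    then have [measurable]: "(\<lambda>X. \<rho> (c X i (fst p)) (c X i (fst q))) \<in> borel_measurable ?M"
      unfolding \<rho>_def
      by (rule measurable_comp_countable[of _ _ D'])
        (use D' in \<open>simp add: wo_distances_def\<close>, rule inD'[OF _ subsetD[OF A_sub c_in] subsetD[OF A_sub c_in]])
    show ?thesis unfolding \<delta>_def double_def fst_conv snd_conv by measurable
  qed
  have "\<exists>h. (\<forall>X\<in>space ?M. \<forall>p q. dist (h X p) (h X q) = \<delta> i X p q) \<and>
      (\<lambda>X. range (h X)) \<in> ?M \<rightarrow>\<^sub>M (ultrametric_subspaces D :: 'u set measure)" for i
    using measurable_realization[OF U D \<delta> meas, of i] by metis
  then obtain h :: "nat \<Rightarrow> 'u set \<Rightarrow> nat \<times> bool \<Rightarrow> 'u" where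
    h: "\<And>i X p q. X \<in> space ?M \<Longrightarrow> dist (h i X p) (h i X q) = \<delta> i X p q"
    and h_meas: "\<And>i. (\<lambda>X. range (h i X)) \<in> ?M \<rightarrow>\<^sub>M (ultrametric_subspaces D :: 'u set measure)"
    by metis
  define F where "F X i = range (h i X)" for X i
  have "(\<lambda>X i. range (h i X)) \<in> ?M \<rightarrow>\<^sub>M sequence_space (ultrametric_subspaces D :: 'u set measure)"
    using h_meas by (intro measurable_PiM_single') (auto simp: PiE_iff dest: measurable_space)
  then have F_meas: "F \<in> ?M \<rightarrow>\<^sub>M sequence_space (ultrametric_subspaces D :: 'u set measure)"
    by (simp add: F_def[abs_def])

  have F_first: "\<exists>q. bij_betw q (A X i \<times> UNIV) (F X i) \<and>
      (\<forall>z\<in>A X i \<times> UNIV. \<forall>w\<in>A X i \<times> UNIV. dist (q z) (q w) = double e \<rho> z w)"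
    if X: "X \<in> space ?M" and i: "first X i" for X i
    unfolding F_def
  proof (rule enumeration_bij)
    show "range (\<lambda>p. (c X i (fst p), snd p)) = A X i \<times> (UNIV :: bool set)"
      unfolding c_range[OF X, of i, symmetric]
      using map_prod_surj_on[OF refl[of "range (c X i)"] refl[of "range (id :: bool \<Rightarrow> bool)"]]
      by (simp add: map_prod_def case_prod_unfold)
    show "dist (h i X p) (h i X q) = double e \<rho> (c X i (fst p), snd p) (c X i (fst q), snd q)" for p q
      using h[OF X] i by (simp add: \<delta>_def)
    fix z w assume zw: "z \<in> A X i \<times> (UNIV :: bool set)" "w \<in> A X i \<times> (UNIV :: bool set)"
    then have "fst z \<in> A X i" "fst w \<in> A X i" by auto
    then have "\<rho> (fst z) (fst w) = 0 \<longleftrightarrow> fst z = fst w" "\<rho> (fst z) (fst w) \<ge> 0"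
      using A_ultra[OF X, of i] e(2) unfolding discrete_ultrametric_def
      by (auto, metis dual_order.trans less_imp_le order_refl)
    then show "double e \<rho> z w = 0 \<longleftrightarrow> z = w"
      using e(2) by (auto simp: double_def max_def prod_eq_iff)
  qed
  have F_not_first: "\<exists>y. F X i = {y}" if X: "X \<in> space ?M" and i: "\<not> first X i" for X i
  proof -
    have "h i X p = h i X (0, True)" for p using h[OF X, of i p "(0, True)"] i by (simp add: \<delta>_def)
    then have "F X i = {h i X (0, True)}" unfolding F_def by (auto intro: range_eqI)
    then show ?thesis by blast
  qed
  have F_two: "\<exists>u\<in>F X i. \<exists>v\<in>F X i. u \<noteq> v" if X: "X \<in> space ?M" and i: "first X i" for X i
  proof -
    have "dist (h i X (0, True)) (h i X (0, False)) \<ge> e"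
      using i by (simp add: h[OF X] \<delta>_def double_def)
    then have "h i X (0, True) \<noteq> h i X (0, False)" using e(2) by auto
    then show ?thesis unfolding F_def by blast
  qed
  have A_cnt: "countable (A X i)" if "X \<in> space ?M" for X i
    unfolding c_range[OF that, symmetric] by simp
  have F_rel: "metric_rel b (F X i) (F Y j) \<longleftrightarrow> metric_rel b (A X i) (A Y j)"
    if XY: "X \<in> space ?M" "Y \<in> space ?M" and ij: "first X i" "first Y j" for b X Y i j
  proof -
    obtain p q where p: "bij_betw p (A X i \<times> UNIV) (F X i)"
        "\<forall>z\<in>A X i \<times> UNIV. \<forall>w\<in>A X i \<times> UNIV. dist (p z) (p w) = double e \<rho> z w"
      and q: "bij_betw q (A Y j \<times> UNIV) (F Y j)"
        "\<forall>z\<in>A Y j \<times> UNIV. \<forall>w\<in>A Y j \<times> UNIV. dist (q z) (q w) = double e \<rho> z w"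
      using F_first[OF XY(1) ij(1)] F_first[OF XY(2) ij(2)] by meson
    have "metric_rel b (F X i) (F Y j) \<longleftrightarrow>
        dist_rel b (A X i \<times> UNIV) (double e \<rho>) (A Y j \<times> UNIV) (double e \<rho>)"
      unfolding metric_rel_def using p q by (intro dist_rel_reindex[symmetric, of p _ _ _ _ q]) auto
    also have "\<dots> \<longleftrightarrow> dist_rel b (A X i) \<rho> (A Y j) \<rho>"
      by (rule dist_rel_double[OF e(2) A_cnt[OF XY(1)] A_cnt[OF XY(2)] A_ultra[OF XY(1)] A_ultra[OF XY(2)]])
    also have "\<dots> \<longleftrightarrow> metric_rel b (A X i) (A Y j)"
      unfolding metric_rel_def \<rho>_def[abs_def] using A_dist XY
      by (intro dist_rel_rescale[OF \<psi>inj]) blast+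
    finally show ?thesis .
  qed
  have A_cover: "X = (\<Union>i\<in>Collect (first X). A X i)" if X: "X \<in> space ?M" for X
  proof
    show "X \<subseteq> (\<Union>i\<in>Collect (first X). A X i)"
    proof
      fix x assume x: "x \<in> X"
      then obtain n where "x = t X n" using t_range[OF X] by auto
      then have ex: "\<exists>i. dist (t X i) x < r" using r(1) by (intro exI[of _ n]) simp
      \<comment> \<open>The least index whose point is within r of x starts its ball: an earlier
        point in that ball would also be within r of x.\<close>
      define i where "i = (LEAST i. dist (t X i) x < r)"
      have i: "dist (t X i) x < r" unfolding i_def by (rule LeastI_ex[OF ex])
      have "first X i" unfolding first_def
      proof (intro allI impI notI)
        fix j assume j: "j < i" "dist (t X j) (t X i) < r"
        have "dist (t X j) x < r"
          using ult[OF X t_in[OF X, of j] t_in[OF X, of i] x] i j(2) by simp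
        with j(1) show False unfolding i_def by (blast dest: not_less_Least)
      qed
      with i x show "x \<in> (\<Union>i\<in>Collect (first X). A X i)"
        by (auto simp: A_def dist_commute)
    qed
  qed (use A_sub in blast)
  have A_ne: "A X i \<noteq> {}" if "X \<in> space ?M" for X i using c_in[OF that] by blast
  have A_across: "dist u v = r"
    if X: "X \<in> space ?M" and ij: "i \<in> Collect (first X)" "j \<in> Collect (first X)" "i \<noteq> j"
      and uv: "u \<in> A X i" "v \<in> A X j" for X i j u v
  proof -
    \<comment> \<open>The centres of different selected balls are at least r apart, and by the
      ultrametric inequality so are their points; since r is the largest distance, equality
      holds.\<close>
    have "\<not> dist (t X i) (t X j) < r"
      using ij dist_commute[of "t X i" "t X j"] by (cases i j rule: linorder_cases) (auto simp: first_def)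
    moreover have "dist (t X i) (t X j) < r" if uv_lt: "dist u v < r"
    proof -
      have "dist u (t X j) < r"
        using ult[OF X, of u v "t X j"] uv uv_lt t_in[OF X] by (auto simp: A_def)
      then show ?thesis
        using ult[OF X, of "t X i" u "t X j"] uv t_in[OF X] by (auto simp: A_def dist_commute)
    qed
    ultimately have "\<not> dist u v < r" by blast
    moreover have "dist u v \<le> r" using r(3) inD'[OF X] uv A_sub by blast
    ultimately show ?thesis by simp
  qed
  have inf: "infinite (- Collect (first X))" for X
  proof -
    \<comment> \<open>An odd index repeats the point listed just before it, so it never starts a
      ball.\<close>
    have "Suc (2 * k) \<notin> Collect (first X)" for k
      unfolding first_def using r(1) by (auto intro!: exI[of _ "2 * k"] simp: t_def)
    then have "range (\<lambda>k. Suc (2 * k)) \<subseteq> - Collect (first X)" by blast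
    moreover have "infinite (range (\<lambda>k::nat. Suc (2 * k)))"
      by (intro range_inj_infinite injI) simp
    ultimately show ?thesis using finite_subset by blast
  qed
  have "metric_rel b X Y \<longleftrightarrow> power_rel b (F X) (F Y)"
    if XY: "X \<in> space ?M" "Y \<in> space ?M" for b X Y
  proof -
    let ?I = "Collect (first X)" and ?J = "Collect (first Y)"
    have "metric_rel b (\<Union>i\<in>?I. A X i) (\<Union>i\<in>?J. A Y i) \<longleftrightarrow>
        (\<exists>\<pi>. inj_on \<pi> ?I \<and> \<pi> ` ?I \<subseteq> ?J \<and> (b \<longrightarrow> \<pi> ` ?I = ?J) \<and>
          (\<forall>i\<in>?I. metric_rel b (A X i) (A Y (\<pi> i))))"
      by (rule metric_rel_partition[OF r(1) A_ne[OF XY(1)] A_ne[OF XY(2)] A_within[OF XY(1)]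
            A_within[OF XY(2)] A_across[OF XY(1)] A_across[OF XY(2)]])
    then have "metric_rel b X Y \<longleftrightarrow> (\<exists>\<pi>. inj_on \<pi> ?I \<and> \<pi> ` ?I \<subseteq> ?J \<and> (b \<longrightarrow> \<pi> ` ?I = ?J) \<and>
        (\<forall>i\<in>?I. metric_rel b (A X i) (A Y (\<pi> i))))" (is "_ \<longleftrightarrow> ?R")
      using A_cover[OF XY(1)] A_cover[OF XY(2)] by simp
    also have "?R \<longleftrightarrow> power_rel b (F X) (F Y)"
    proof
      assume ?R
      then obtain \<pi> where \<pi>: "inj_on \<pi> ?I" "\<pi> ` ?I \<subseteq> ?J" "b \<longrightarrow> \<pi> ` ?I = ?J"
        "\<And>i. i \<in> ?I \<Longrightarrow> metric_rel b (A X i) (A Y (\<pi> i))" by blast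
      have "infinite (- (\<pi> ` ?I))"
        \<comment> \<open>The complement of the image contains the complement of \<open>?J\<close>,
          which is infinite.\<close>
        using inf[of Y] \<pi>(2) finite_subset[of "- ?J" "- (\<pi> ` ?I)"] by blast
      then obtain \<sigma> where \<sigma>: "bij \<sigma>" "\<forall>i\<in>?I. \<sigma> i = \<pi> i"
        using bij_extend[OF \<pi>(1) inf] by blast
      have "metric_rel b (F X i) (F Y (\<sigma> i))" for i
      proof (cases "first X i")
        case True
        then have "first Y (\<pi> i)" using \<pi>(2) by auto
        with True show ?thesis using \<pi>(4)[of i] \<sigma>(2) F_rel[OF XY] by simp
      next
        case False
        then obtain x where x: "F X i = {x}" using F_not_first[OF XY(1)] by blast
        \<comment> \<open>For isometries \<pi> already exhausts the ball positions of Y, so the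
          injective \<sigma> leaves only padding positions for padding.\<close>
        have "\<exists>y. F Y (\<sigma> i) = {y}" if surj: b
        proof (rule F_not_first[OF XY(2)], rule notI)
          assume "first Y (\<sigma> i)"
          then obtain i' where "i' \<in> ?I" "\<sigma> i = \<pi> i'" using \<pi>(3) surj by blast
          then have "\<sigma> i = \<sigma> i'" "first X i'" using \<sigma>(2) by auto
          with False show False using bij_is_inj[OF \<sigma>(1)] by (auto dest: injD)
        qed
        then show ?thesis unfolding x by (intro metric_rel_singleton) (auto simp: F_def)
      qed
      then show "power_rel b (F X) (F Y)"
        unfolding power_rel_def using \<sigma>(1) by (intro exI[of _ \<sigma>]) (auto simp: bij_def)
    next
      assume "power_rel b (F X) (F Y)"
      then obtain \<sigma> where \<sigma>: "inj \<sigma>" "b \<longrightarrow> surj \<sigma>" "\<And>i. metric_rel b (F X i) (F Y (\<sigma> i))"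
        unfolding power_rel_def by blast
      have fwd: "first Y (\<sigma> i)" if "first X i" for i
        using F_two[OF XY(1) that] F_not_first[OF XY(2), of "\<sigma> i"] \<sigma>(3)[of i]
          metric_rel_into_singleton by metis
      have bwd: "first X i" if b "first Y (\<sigma> i)" for i
        using F_two[OF XY(2) that(2)] F_not_first[OF XY(1), of i] \<sigma>(3)[of i] that(1)
          metric_rel_from_singleton by metis
      have "?J \<subseteq> \<sigma> ` ?I" if surj: b
      proof
        fix j assume j: "j \<in> ?J"
        obtain i where "j = \<sigma> i" using \<sigma>(2) surj by (meson surjD)
        with j bwd[OF surj] show "j \<in> \<sigma> ` ?I" by auto
      qed
      moreover have "\<sigma> ` ?I \<subseteq> ?J" using fwd by auto
      moreover have "metric_rel b (A X i) (A Y (\<sigma> i))" if "i \<in> ?I" for i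
        using that \<sigma>(3)[of i] F_rel[OF XY _ fwd] by simp
      moreover have "inj_on \<sigma> ?I" using \<sigma>(1) by (rule inj_on_subset) simp
      ultimately show ?R by (intro exI[of _ \<sigma>]) blast
    qed
    finally show ?thesis .
  qed
  with F_meas show ?thesis by blast
qed

section \<open>Combining the two reductions for isometry and embeddability\<close>

theorem theorem5p13:
  fixes \<alpha> :: "'a rel" and D D' :: "real set"
  assumes "urysohn_space TYPE('u::polish_space)"
    and "Well_order \<alpha>" and "countable (Field \<alpha>)" and "natLeq_on 1 <o \<alpha>"
    and "distance_set_of_type \<alpha> D"
    and "distance_set_of_type (ord_succ \<alpha>) D'"
  shows "borel_bireducible
           (ultrametric_subspaces D' :: 'u set measure) isometric
           (sequence_space (ultrametric_subspaces D :: 'u set measure))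
           (qo_equiv (inj_power isometric))
       \<and> borel_bireducible
           (ultrametric_subspaces D' :: 'u set measure) isometrically_embeds
           (sequence_space (ultrametric_subspaces D :: 'u set measure))
           (inj_power isometrically_embeds)"
proof -
  note D = wo_distances_of_type[OF assms(5)] and D' = wo_distances_of_type[OF assms(6)]
  obtain d where d: "d \<in> D" "d > 0" using distance_set_nontrivial[OF assms(5,4)] by blast
  obtain r \<phi> where r: "r > 0" "r \<in> D'" "\<And>x. x \<in> D' \<Longrightarrow> x \<le> r"
    and \<phi>: "bij_betw \<phi> D (D' - {r})" "\<And>x y. x \<in> D \<Longrightarrow> y \<in> D \<Longrightarrow> \<phi> x \<le> \<phi> y \<longleftrightarrow> x \<le> y" "\<phi> 0 = 0"
    using distance_set_succ[OF assms(5,6)] by blast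
  define \<psi> where "\<psi> = inv_into D \<phi>"
  have \<psi>: "bij_betw \<psi> (D' - {r}) D" unfolding \<psi>_def by (rule bij_betw_inv_into[OF \<phi>(1)])
  have \<psi>_order: "\<psi> x \<le> \<psi> y \<longleftrightarrow> x \<le> y" if "x \<in> D' - {r}" "y \<in> D' - {r}" for x y
    using \<phi>(2)[of "\<psi> x" "\<psi> y"] bij_betwE[OF \<psi>] that bij_betw_inv_into_right[OF \<phi>(1)]
    by (simp add: \<psi>_def)
  have "0 \<in> D" using D by (simp add: wo_distances_def)
  then have "\<psi> 0 = 0" using bij_betw_inv_into_left[OF \<phi>(1), of 0] by (simp add: \<psi>_def \<phi>(3))
  then have red1: "\<exists>F \<in> (ultrametric_subspaces D' :: 'u set measure) \<rightarrow>\<^sub>M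
      sequence_space (ultrametric_subspaces D :: 'u set measure).
      \<forall>X\<in>space (ultrametric_subspaces D'). \<forall>Y\<in>space (ultrametric_subspaces D').
      \<forall>b. metric_rel b X Y \<longleftrightarrow> power_rel b (F X) (F Y)"
    by (intro metric_rel_reduction[OF assms(1) D d D' r \<psi>] \<psi>_order)
  note red2 = power_rel_reduction[OF assms(1) D d D' r \<phi>]
  show ?thesis
    unfolding borel_bireducible_def borel_reducible_def metric_rel_True[symmetric]
      metric_rel_False[symmetric] power_rel_True[symmetric, unfolded metric_rel_True[symmetric]]
      power_rel_False[symmetric, unfolded metric_rel_False[symmetric]]
    using red1 red2 by blast
qed

end
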